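(* Let $l$ be a prime number, let $\mathcal{T}_l\cong\prod_{k\in\mathbb{N}}\mathbb{Z}/l^k\mathbb{Z}$ (a pro-$l$ abelian group), and let $A$ be a finite abelian $l$-group. Then there exists a unique (up to isomorphism of topological groups) pro-$l$ abelian group $\mathcal{D}$ such that: (1) there is an exact sequence of pro-$l$ abelian groups (with continuous homomorphisms) $0\to\mathcal{T}_l\to\mathcal{D}\to A\to 0$; and (2) the topological closure of the torsion subgroup of $\mathcal{D}$ equals (the image of) $\mathcal{T}_l$. *)

theory Defs
  imports "HOL-Analysis.Analysis" "HOL-Algebra.Algebra"
begin

definition topological_group :: "'a monoid \<Rightarrow> 'a topology \<Rightarrow> bool" where
  "topological_group G TG \<longleftrightarrow>
     group G \<and> topspace TG = carrier G \<and>
     continuous_map (prod_topology TG TG) TG (\<lambda>(x, y). mult G x y) \<and>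
     continuous_map TG TG (\<lambda>x. m_inv G x)"

definition pro_l_abelian :: "nat \<Rightarrow> 'a monoid \<Rightarrow> 'a topology \<Rightarrow> bool" where
  "pro_l_abelian l G TG \<longleftrightarrow>
     topological_group G TG \<and> comm_group G \<and> compact_space TG \<and> Hausdorff_space TG \<and>
     (\<forall>U. openin TG U \<and> one G \<in> U \<longrightarrow> (\<exists>H. subgroup H G \<and> openin TG H \<and> H \<subseteq> U)) \<and>
     (\<forall>H. subgroup H G \<and> openin TG H \<longrightarrow> (\<exists>n. card (RCOSETS G H) = l ^ n))"

definition torsion :: "'a monoid \<Rightarrow> 'a set" where
  "torsion G = {x \<in> carrier G. \<exists>n::nat. n > 0 \<and> pow G x n = one G}"

(* The group T_l = prod_{k in N} Z/l^k Z, realised on sequences f with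
   0 <= f k < l^k, componentwise addition mod l^k (the k = 0 factor is trivial). *)
definition Tl_group :: "nat \<Rightarrow> (nat \<Rightarrow> int) monoid" where
  "Tl_group l = \<lparr> carrier = {f. \<forall>k. 0 \<le> f k \<and> f k < int l ^ k},
                  mult = (\<lambda>f g k. (f k + g k) mod (int l ^ k)),
                  one = (\<lambda>k. 0) \<rparr>"

definition Tl_top :: "nat \<Rightarrow> (nat \<Rightarrow> int) topology" where
  "Tl_top l = product_topology (\<lambda>k. discrete_topology {0..<int l ^ k}) UNIV"

definition good_extension ::
  "nat \<Rightarrow> 'a monoid \<Rightarrow> 'd monoid \<Rightarrow> 'd topology \<Rightarrow> bool" where
  "good_extension l A D TG \<longleftrightarrow>
     pro_l_abelian l D TG \<and>
     (\<exists>i p. i \<in> hom (Tl_group l) D \<and> continuous_map (Tl_top l) TG i \<and>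
            inj_on i (carrier (Tl_group l)) \<and>
            p \<in> hom D A \<and> continuous_map TG (discrete_topology (carrier A)) p \<and>
            p ` carrier D = carrier A \<and>
            i ` carrier (Tl_group l) = kernel D A p \<and>
            TG closure_of (torsion D) = i ` carrier (Tl_group l))"

definition top_group_iso ::
  "'a monoid \<Rightarrow> 'a topology \<Rightarrow> 'b monoid \<Rightarrow> 'b topology \<Rightarrow> bool" where
  "top_group_iso G TG H TH \<longleftrightarrow> (\<exists>\<phi>. \<phi> \<in> iso G H \<and> homeomorphic_map TG TH \<phi>)"

end

theory Submission
  imports Defs
begin

text \<open>
  Existence: let \<open>q = |A|\<close> and choose characters \<open>\<psi>\<^sub>k : A \<rightarrow> \<int>/q\<close> such that every
  nontrivial \<open>a\<close> is detected by infinitely many \<open>\<psi>\<^sub>k\<close>. The tuples \<open>(z, a)\<close> with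
  \<open>z\<^sub>k \<in> \<int>/ql\<^sup>k\<close> lifting \<open>\<psi>\<^sub>k(a)\<close> form an extension of \<open>A\<close> by \<open>T\<^sub>l\<close>; if \<open>\<psi>\<^sub>k(a) \<noteq> 0\<close>, the
  order of \<open>z\<^sub>k\<close> is at least \<open>l\<^sup>k\<close>, so nothing over \<open>a\<close> is torsion.

  Uniqueness: let \<open>P = D \<times>\<^sub>A G\<close> for two extensions \<open>D\<close>, \<open>G\<close> of \<open>A\<close> by \<open>T\<^sub>l\<close>. As \<open>\<int>/l\<^sup>k\<close> is
  injective among groups of exponent \<open>l\<^sup>k\<close>, there is a homomorphism
  \<open>h\<^sub>k : P \<rightarrow> \<int>/l\<^sup>k\<close> with \<open>h\<^sub>k(t, u) = u\<^sub>k - t\<^sub>k\<close> on those \<open>(t, u) \<in> T\<^sub>l \<times> T\<^sub>l\<close> for which \<open>t\<close>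
  vanishes on a finite set of coordinates that rules out \<open>l\<^sup>k\<close>-torsion outside \<open>T\<^sub>l\<close>;
  such sets exist arbitrarily far out by compactness, and the roles of \<open>D\<close> and \<open>G\<close> can be
  exchanged. Split \<open>\<nat>\<close> into \<open>S\<close> and its complement, both containing such sets for all \<open>k\<close>;
  use sets inside \<open>S\<close> and \<open>t\<close> for \<open>k \<notin> S\<close>, sets outside \<open>S\<close> and \<open>u\<close> for \<open>k \<in> S\<close>. Then the
  system \<open>h\<^sub>k = 0\<close> is triangular in \<open>t\<close> and also in \<open>u\<close>, so its solution set is the graph of
  an isomorphism \<open>D \<rightarrow> G\<close>.\<close>

section \<open>Extension of characters\<close>

text \<open>\<open>R\<close> is the graph of a homomorphism to \<open>\<int>/q\<close> from a subgroup of \<open>G\<close>, with every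
  representative of a value allowed.\<close>

definition mod_graph :: "('a, 'b) monoid_scheme \<Rightarrow> int \<Rightarrow> ('a \<times> int) set \<Rightarrow> bool" where
  "mod_graph G q R \<longleftrightarrow>
     R \<subseteq> carrier G \<times> UNIV \<and>
     (\<forall>x a y b. (x, a) \<in> R \<longrightarrow> (y, b) \<in> R \<longrightarrow> (x \<otimes>\<^bsub>G\<^esub> y, a + b) \<in> R) \<and>
     (\<forall>x a. (x, a) \<in> R \<longrightarrow> (inv\<^bsub>G\<^esub> x, - a) \<in> R) \<and>
     (\<forall>a. (\<one>\<^bsub>G\<^esub>, a) \<in> R \<longrightarrow> q dvd a)"

lemma mod_graphD:
  assumes "mod_graph G q R"
  shows "(x, a) \<in> R \<Longrightarrow> x \<in> carrier G"
    and "(x, a) \<in> R \<Longrightarrow> (y, b) \<in> R \<Longrightarrow> (x \<otimes>\<^bsub>G\<^esub> y, a + b) \<in> R"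
    and "(x, a) \<in> R \<Longrightarrow> (inv\<^bsub>G\<^esub> x, - a) \<in> R"
    and "(\<one>\<^bsub>G\<^esub>, a) \<in> R \<Longrightarrow> q dvd a"
  using assms unfolding mod_graph_def by blast+

lemma (in group) mod_graph_int_pow:
  fixes j :: int
  assumes "mod_graph G q R" "(x, a) \<in> R"
  shows "(x [^] j, j * a) \<in> R"
proof -
  note add = mod_graphD(2)[OF assms(1)] and neg = mod_graphD(3)[OF assms(1)]
  have x: "x \<in> carrier G" using assms mod_graphD(1) by metis
  have nat: "(x [^] n, int n * a) \<in> R" for n :: nat
  proof (induction n)
    case 0
    show ?case using add[OF assms(2) neg[OF assms(2)]] x by simp
  next
    case (Suc n)
    show ?case using add[OF Suc assms(2)] x by (simp add: algebra_simps)
  qed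
  show ?thesis
  proof (cases j rule: int_cases2)
    case (nonneg n)
    then show ?thesis using nat[of n] by (simp add: int_pow_int)
  next
    case (nonpos n)
    then show ?thesis using neg[OF nat[of n]] x by (simp add: int_pow_neg_int)
  qed
qed

text \<open>Let \<open>n\<close> be the least positive exponent with \<open>x [^] n\<close> in the
  domain, \<open>z0\<close> a value there, and \<open>q = n * r\<close>. Since
  \<open>x [^] q\<close> has both values \<open>r * z0\<close> and \<open>0\<close>,
  \<open>q\<close> divides \<open>r * z0\<close>; hence \<open>n\<close> divides \<open>z0\<close>,
  and \<open>c = z0 / n\<close> can serve as the value at \<open>x\<close>.\<close>

lemma (in comm_group) mod_graph_adjoin:
  assumes R: "mod_graph G q R" and x: "x \<in> carrier G" and "0 < q"
    and pow_q: "(x [^] q, 0) \<in> R"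
  obtains R' c where "mod_graph G q R'" "R \<subseteq> R'" "(x, c) \<in> R'"
proof -
  note car = mod_graphD(1)[OF R] and add = mod_graphD(2)[OF R]
    and neg = mod_graphD(3)[OF R] and one = mod_graphD(4)[OF R]
  have zero: "(\<one>, 0) \<in> R"
    using add[OF pow_q neg[OF pow_q]] x by simp
  define n where "n = (LEAST n::nat. n > 0 \<and> (\<exists>z. (x [^] n, z) \<in> R))"
  have "nat q > 0 \<and> (\<exists>z. (x [^] nat q, z) \<in> R)"
    using pow_q \<open>0 < q\<close> by (auto simp flip: int_pow_int)
  then have n: "n > 0 \<and> (\<exists>z. (x [^] n, z) \<in> R)"
    unfolding n_def by (rule LeastI)
  then obtain z0 where "(x [^] n, z0) \<in> R" by blast
  then have z0: "(x [^] int n, z0) \<in> R" by (simp add: int_pow_int)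
  \<comment> \<open>Division with remainder: the remainder of \<open>j\<close> modulo
    \<open>n\<close> is again such an exponent, so minimality of \<open>n\<close> makes it
    zero.\<close>
  have dvd: "int n dvd j" if "(x [^] j, z) \<in> R" for j z :: int
  proof (rule ccontr)
    assume "\<not> int n dvd j"
    then have "j mod int n \<noteq> 0" by (simp add: dvd_eq_mod_eq_0)
    then have pos: "j mod int n > 0"
      using pos_mod_sign[of "int n" j] n by linarith
    have "(x [^] (j - int n * (j div int n)), z - (j div int n) * z0) \<in> R"
      using add[OF that neg[OF mod_graph_int_pow[OF R z0, of "j div int n"]]] x
      by (simp add: int_pow_diff int_pow_pow mult.commute)
    then have "(x [^] (j mod int n), z - (j div int n) * z0) \<in> R"
      by (simp add: minus_mult_div_eq_mod)
    then have "nat (j mod int n) > 0 \<and> (\<exists>z. (x [^] nat (j mod int n), z) \<in> R)"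
      using pos by (auto simp flip: int_pow_int)
    then have "n \<le> nat (j mod int n)"
      unfolding n_def by (rule Least_le)
    then show False
      using n pos_mod_bound[of "int n" j] by linarith
  qed
  obtain r where r: "q = int n * r" using dvd[OF pow_q] by blast
  have "(x [^] q, r * z0) \<in> R"
    using mod_graph_int_pow[OF R z0, of r] x by (simp add: int_pow_pow r mult.commute)
  from add[OF this neg[OF pow_q]] have "(\<one>, r * z0) \<in> R"
    using x by simp
  then have "int n * r dvd r * z0" using one r by auto
  then have "int n dvd z0" using r \<open>0 < q\<close> by (auto simp: mult.commute)
  then obtain c where c: "z0 = int n * c" by blast
  define R' where "R' = {(y \<otimes> x [^] (j :: int), b + j * c) | y b j. (y, b) \<in> R}"
  have R'I: "(y, b) \<in> R \<Longrightarrow> w = y \<otimes> x [^] j \<Longrightarrow> d = b + j * c \<Longrightarrow> (w, d) \<in> R'"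
    for y b w d and j :: int unfolding R'_def by blast
  have "mod_graph G q R'"
    unfolding mod_graph_def
  proof (intro conjI allI impI)
    show "R' \<subseteq> carrier G \<times> UNIV" using car x by (auto simp: R'_def)
  next
    fix v a w b assume "(v, a) \<in> R'" "(w, b) \<in> R'"
    then obtain y d j y' d' j' where *: "(y, d) \<in> R" "v = y \<otimes> x [^] j" "a = d + j * c"
      "(y', d') \<in> R" "w = y' \<otimes> x [^] j'" "b = d' + j' * c"
      unfolding R'_def by blast
    show "(v \<otimes> w, a + b) \<in> R'"
    proof (rule R'I[OF add[OF *(1,4)], where j = "j + j'"])
      show "v \<otimes> w = y \<otimes> y' \<otimes> x [^] (j + j')"
        using * car x by (simp add: int_pow_mult m_ac)
    qed (simp add: * algebra_simps)
  next
    fix v a assume "(v, a) \<in> R'"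
    then obtain y d j where *: "(y, d) \<in> R" "v = y \<otimes> x [^] j" "a = d + j * c"
      unfolding R'_def by blast
    show "(inv v, - a) \<in> R'"
    proof (rule R'I[OF neg[OF *(1)], where j = "- j"])
      show "inv v = inv y \<otimes> x [^] (- j)"
        using * car x by (simp add: int_pow_neg inv_mult)
    qed (simp add: *)
  next
    fix a assume "(\<one>, a) \<in> R'"
    then obtain y d j where *: "(y, d) \<in> R" "y \<otimes> x [^] j = \<one>" "a = d + j * c"
      unfolding R'_def by force
    have y: "y = inv (x [^] j)" using inv_equality[OF *(2)] car[OF *(1)] x by simp
    then have "(x [^] j, - d) \<in> R" using neg[OF *(1)] x by simp
    then obtain s where s: "j = int n * s" using dvd by blast
    \<comment> \<open>Since \<open>j = n * s\<close>, the new value \<open>j * c\<close> equals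
      \<open>s * z0\<close>, which \<open>R\<close> already assigns to \<open>x [^] j\<close>; the
      condition at the identity is thus inherited from \<open>R\<close>.\<close>
    have "(y \<otimes> x [^] j, d + s * z0) \<in> R"
      using add[OF *(1) mod_graph_int_pow[OF R z0, of s]] x by (simp add: s int_pow_pow)
    then have "(\<one>, a) \<in> R" using *(2) by (simp add: * s c mult_ac)
    then show "q dvd a" by (rule one)
  qed
  moreover have "R \<subseteq> R'"
  proof
    fix w assume "w \<in> R"
    moreover obtain y b where "w = (y, b)" by (cases w)
    ultimately show "w \<in> R'" using car R'I[of y b y 0 b] by simp
  qed
  moreover have "(x, c) \<in> R'" using x by (intro R'I[OF zero, where j = 1]) simp_all
  ultimately show thesis using that by blast
qed

text \<open>Injectivity of \<open>\<int>/q\<close> among groups of exponent \<open>q\<close>; the hypothesis \<open>pow_q\<close> makes the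
  partial character trivial on \<open>q\<close>-th powers.\<close>

lemma (in comm_group) extend_mod_graph:
  assumes R: "mod_graph G q R" and q: "0 < q"
    and pow_q: "\<And>x. x \<in> carrier G \<Longrightarrow> (x [^] q, 0) \<in> R"
  obtains h where "\<And>x y. x \<in> carrier G \<Longrightarrow> y \<in> carrier G \<Longrightarrow> q dvd h (x \<otimes> y) - h x - h y"
    and "\<And>x z. (x, z) \<in> R \<Longrightarrow> q dvd h x - z"
proof -
  let ?Q = "{S. mod_graph G q S \<and> R \<subseteq> S}"
  have "\<exists>M\<in>?Q. \<forall>N\<in>?Q. M \<subseteq> N \<longrightarrow> N = M"
  proof (rule subset_Zorn_nonempty)
    show "?Q \<noteq> {}" using R by blast
  next
    fix C assume C: "C \<noteq> {}" "subset.chain ?Q C"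
    have CA: "S \<in> C \<Longrightarrow> mod_graph G q S \<and> R \<subseteq> S" for S
      using C(2) unfolding subset.chain_def by auto
    have lin: "S \<in> C \<Longrightarrow> S' \<in> C \<Longrightarrow> S \<subseteq> S' \<or> S' \<subseteq> S" for S S'
      using C(2) unfolding subset_chain_def by auto
    have "mod_graph G q (\<Union>C)"
      unfolding mod_graph_def
    proof (intro conjI allI impI)
      show "\<Union>C \<subseteq> carrier G \<times> UNIV"
        using CA unfolding mod_graph_def by (meson Union_least)
    next
      fix x a y b assume "(x, a) \<in> \<Union>C" "(y, b) \<in> \<Union>C"
      then obtain S S' where "S \<in> C" "S' \<in> C" "(x, a) \<in> S" "(y, b) \<in> S'" by blast
      then obtain S where S: "S \<in> C" "(x, a) \<in> S" "(y, b) \<in> S"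
        using lin[of S S'] by (meson subsetD)
      then have "(x \<otimes> y, a + b) \<in> S" using CA mod_graphD(2) by metis
      then show "(x \<otimes> y, a + b) \<in> \<Union>C" using S by blast
    next
      fix x a assume "(x, a) \<in> \<Union>C"
      then obtain S where S: "S \<in> C" "(x, a) \<in> S" by blast
      then have "(inv x, - a) \<in> S" using CA mod_graphD(3) by metis
      then show "(inv x, - a) \<in> \<Union>C" using S by blast
    next
      fix a assume "(\<one>, a) \<in> \<Union>C"
      then obtain S where S: "S \<in> C" "(\<one>, a) \<in> S" by blast
      then show "q dvd a" using CA mod_graphD(4) by metis
    qed
    moreover have "R \<subseteq> \<Union>C" using C(1) CA by fast
    ultimately show "\<Union>C \<in> ?Q" by simp
  qed
  then obtain M where MQ: "M \<in> ?Q" and maxQ: "\<forall>N\<in>?Q. M \<subseteq> N \<longrightarrow> N = M" ..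
  then have M: "mod_graph G q M" "R \<subseteq> M" by simp_all
  have max: "N = M" if "mod_graph G q N" "M \<subseteq> N" for N
    using maxQ that subset_trans[OF M(2)] by simp
  \<comment> \<open>Adjoining \<open>x\<close> cannot enlarge a maximal graph, so \<open>x\<close>
    is already in its domain.\<close>
  have total: "\<exists>z. (x, z) \<in> M" if x: "x \<in> carrier G" for x
  proof -
    obtain R' c where "mod_graph G q R'" "M \<subseteq> R'" "(x, c) \<in> R'"
      using mod_graph_adjoin[OF M(1) x q] pow_q[OF x] M(2) by (metis subsetD)
    then show ?thesis using max[of R'] by auto
  qed
  define h where "h x = (SOME z. (x, z) \<in> M)" for x
  have h: "(x, h x) \<in> M" if "x \<in> carrier G" for x
    unfolding h_def using total[OF that] by (rule someI_ex)
  have unique: "q dvd a - b" if ab: "(x, a) \<in> M" "(x, b) \<in> M" for x a b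
  proof -
    have "(x \<otimes> inv x, a + - b) \<in> M"
      using mod_graphD(2)[OF M(1) ab(1) mod_graphD(3)[OF M(1) ab(2)]] .
    then have "(\<one>, a - b) \<in> M" using mod_graphD(1)[OF M(1) ab(1)] by simp
    then show ?thesis by (rule mod_graphD(4)[OF M(1)])
  qed
  show thesis
  proof
    fix x y assume xy: "x \<in> carrier G" "y \<in> carrier G"
    have "(x \<otimes> y, h x + h y) \<in> M" using mod_graphD(2)[OF M(1) h h] xy by simp
    from unique[OF h this] show "q dvd h (x \<otimes> y) - h x - h y"
      using xy by (simp add: algebra_simps)
  next
    fix x z assume "(x, z) \<in> R"
    then have "(x, z) \<in> M" using M(2) by blast
    then show "q dvd h x - z" by (intro unique[OF h] mod_graphD(1)[OF M(1)])
  qed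
qed

text \<open>With \<open>q\<close> the group order and \<open>r = q / ord a\<close>, sending
  \<open>a [^] j\<close> to \<open>j * r\<close> is well defined modulo \<open>q\<close> on the
  cyclic group of \<open>a\<close> and nonzero at \<open>a\<close>. It extends to the whole group
  because \<open>q\<close> annihilates the group.\<close>

lemma (in comm_group) separating_character:
  assumes fin: "finite (carrier G)" and a: "a \<in> carrier G" "a \<noteq> \<one>"
  obtains h where "\<And>x y. x \<in> carrier G \<Longrightarrow> y \<in> carrier G \<Longrightarrow> int (order G) dvd h (x \<otimes> y) - h x - h y"
    and "\<not> int (order G) dvd h a"
proof -
  define q where "q = int (order G)"
  have q: "q > 0" using fin unfolding q_def by (simp add: order_gt_0_iff_finite)
  obtain r where r: "q = int (ord a) * r"
    using ord_dvd_group_order[OF a(1)] unfolding q_def by (metis dvdE of_nat_mult)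
  define R where "R = {(a [^] j, j * r + q * m) | j m. True}"
  have RI: "w = a [^] j \<Longrightarrow> d = j * r + q * m \<Longrightarrow> (w, d) \<in> R" for w d j m
    unfolding R_def by blast
  have "mod_graph G q R"
    unfolding mod_graph_def
  proof (intro conjI allI impI)
    show "R \<subseteq> carrier G \<times> UNIV" using a by (auto simp: R_def)
  next
    fix x b y c assume "(x, b) \<in> R" "(y, c) \<in> R"
    then obtain j m j' m' where "x = a [^] j" "b = j * r + q * m"
      "y = a [^] j'" "c = j' * r + q * m'" unfolding R_def by blast
    then show "(x \<otimes> y, b + c) \<in> R"
      using a by (intro RI[where j = "j + j'" and m = "m + m'"])
        (simp_all add: int_pow_mult distrib_left distrib_right)
  next
    fix x b assume "(x, b) \<in> R"
    then obtain j m where "x = a [^] j" "b = j * r + q * m" unfolding R_def by blast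
    then show "(inv x, - b) \<in> R"
      using a by (intro RI[where j = "- j" and m = "- m"])
        (auto simp: int_pow_neg algebra_simps)
  next
    fix b assume "(\<one>, b) \<in> R"
    then obtain j m where *: "a [^] j = \<one>" "b = j * r + q * m" unfolding R_def by force
    then have "int (ord a) dvd j" using a int_pow_eq_id by simp
    then have "q dvd j * r" using r by auto
    then show "q dvd b" using * by simp
  qed
  moreover have "(x [^] q, 0) \<in> R" if "x \<in> carrier G" for x
    using that a by (intro RI[where j = 0 and m = 0])
      (auto simp: q_def int_pow_int pow_order_eq_1)
  ultimately obtain h where h: "\<And>x y. x \<in> carrier G \<Longrightarrow> y \<in> carrier G \<Longrightarrow> q dvd h (x \<otimes> y) - h x - h y"
    and hR: "\<And>x z. (x, z) \<in> R \<Longrightarrow> q dvd h x - z"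
    using extend_mod_graph[OF _ q] by metis
  have "q dvd h a - r" by (rule hR, rule RI[where j = 1 and m = 0]) (use a in auto)
  \<comment> \<open>As \<open>q = ord a * r\<close> with \<open>r\<close> positive, divisibility
    would force \<open>ord a = 1\<close>, that is, \<open>a = \<one>\<close>.\<close>
  moreover have "\<not> q dvd r"
  proof
    assume "q dvd r"
    moreover have "r > 0" using r q by (metis of_nat_0_le_iff linorder_not_less mult_nonneg_nonpos)
    ultimately have "int (ord a) * r \<le> 1 * r" using r zdvd_imp_le by auto
    then have "ord a \<le> 1" using \<open>r > 0\<close> by (simp add: mult_le_cancel_right)
    moreover have "ord a \<noteq> 0" using r q by (metis mult_zero_left of_nat_0 less_irrefl)
    ultimately have "ord a = 1" by linarith
    then show False using a pow_ord_eq_1[of a] by simp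
  qed
  ultimately have "\<not> q dvd h a" using dvd_diff[of q "h a" "h a - r"] by auto
  then show thesis using that h unfolding q_def by blast
qed

section \<open>The group \<open>T\<^sub>l\<close> and topological groups\<close>

lemma dvd_mod_diff: "q dvd a mod q - a" for a q :: int
  by (simp flip: mod_eq_dvd_iff)

lemma Tl_carrier: "t \<in> carrier (Tl_group l) \<longleftrightarrow> (\<forall>k. 0 \<le> t k \<and> t k < int l ^ k)"
  by (simp add: Tl_group_def)

lemma Tl_mult: "t \<otimes>\<^bsub>Tl_group l\<^esub> u = (\<lambda>k. (t k + u k) mod int l ^ k)"
  by (simp add: Tl_group_def)

lemma Tl_one: "\<one>\<^bsub>Tl_group l\<^esub> = (\<lambda>k. 0)"
  by (simp add: Tl_group_def)

lemma Tl_group_comm_group: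
  assumes "0 < l"
  shows "comm_group (Tl_group l)"
proof (rule comm_groupI)
  show "t \<otimes>\<^bsub>Tl_group l\<^esub> u \<in> carrier (Tl_group l)" for t u
    using assms by (simp add: Tl_carrier Tl_mult)
  show "\<one>\<^bsub>Tl_group l\<^esub> \<in> carrier (Tl_group l)"
    using assms by (simp add: Tl_carrier Tl_one)
  show "t \<otimes>\<^bsub>Tl_group l\<^esub> u \<otimes>\<^bsub>Tl_group l\<^esub> v =
      t \<otimes>\<^bsub>Tl_group l\<^esub> (u \<otimes>\<^bsub>Tl_group l\<^esub> v)" for t u v
    by (simp add: Tl_mult mod_simps add.assoc)
  show "t \<otimes>\<^bsub>Tl_group l\<^esub> u = u \<otimes>\<^bsub>Tl_group l\<^esub> t" for t u
    by (simp add: Tl_mult add.commute)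
next
  fix t assume t: "t \<in> carrier (Tl_group l)"
  show "\<one>\<^bsub>Tl_group l\<^esub> \<otimes>\<^bsub>Tl_group l\<^esub> t = t"
    using t by (simp add: Tl_carrier Tl_mult Tl_one)
  show "\<exists>u\<in>carrier (Tl_group l). u \<otimes>\<^bsub>Tl_group l\<^esub> t = \<one>\<^bsub>Tl_group l\<^esub>"
  proof
    show "(\<lambda>k. (- t k) mod int l ^ k) \<in> carrier (Tl_group l)"
      using assms by (simp add: Tl_carrier)
  qed (simp add: Tl_mult Tl_one mod_simps)
qed

lemma Tl_pow:
  assumes "0 < l"
  shows "t [^]\<^bsub>Tl_group l\<^esub> (n::nat) = (\<lambda>k. (int n * t k) mod int l ^ k)"
proof -
  interpret comm_group "Tl_group l" by (rule Tl_group_comm_group[OF assms])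
  show ?thesis
    by (induction n) (simp_all add: Tl_one Tl_mult mod_simps distrib_right add.commute)
qed

section \<open>The product topology on \<open>T_l\<close> and its torsion\<close>

lemma topspace_Tl_top: "topspace (Tl_top l) = carrier (Tl_group l)"
  by (auto simp: Tl_top_def Tl_group_def PiE_UNIV_domain)

lemma compact_space_Tl_top: "compact_space (Tl_top l)"
  by (simp add: Tl_top_def compact_space_product_topology compact_space_discrete_topology)

lemma continuous_map_Tl_coordinate:
  "continuous_map (Tl_top l) (discrete_topology {0..<int l ^ k}) (\<lambda>t. t k)"
  unfolding Tl_top_def by (rule continuous_map_product_projection) simp

text \<open>These subgroups link topology and torsion: for finite \<open>M\<close> they are open
  neighbourhoods of zero, and for \<open>M = {N..}\<close> and positive \<open>l\<close> they are
  killed by \<open>l ^ N\<close>.\<close>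

definition Tl_vanish :: "nat \<Rightarrow> nat set \<Rightarrow> (nat \<Rightarrow> int) set" where
  "Tl_vanish l M = {t \<in> carrier (Tl_group l). \<forall>m\<in>M. t m = 0}"

lemma closedin_Tl_vanish: "closedin (Tl_top l) (Tl_vanish l M)"
proof -
  \<comment> \<open>\<open>{0} \<inter> {0..<int l ^ m}\<close> lies in the discrete factor even
    when \<open>l = 0\<close>. The empty \<open>M\<close> is treated apart because an intersection
    over it would be the whole type.\<close>
  have "closedin (Tl_top l) (\<Inter>m\<in>M. {t \<in> topspace (Tl_top l). t m \<in> {0} \<inter> {0..<int l ^ m}})"
    if "M \<noteq> {}"
    using that
    by (intro closedin_INT closedin_continuous_map_preimage[OF continuous_map_Tl_coordinate]) auto
  moreover have "Tl_vanish l M = (\<Inter>m\<in>M. {t \<in> topspace (Tl_top l). t m \<in> {0} \<inter> {0..<int l ^ m}})"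
    if "M \<noteq> {}"
    using that by (auto simp: Tl_vanish_def topspace_Tl_top Tl_carrier)
  moreover have "Tl_vanish l {} = topspace (Tl_top l)"
    by (simp add: Tl_vanish_def topspace_Tl_top)
  ultimately show ?thesis by (cases "M = {}") simp_all
qed

lemma openin_Tl_vanish:
  assumes "finite M"
  shows "openin (Tl_top l) (Tl_vanish l M)"
  using assms
proof induction
  case empty
  have "Tl_vanish l {} = topspace (Tl_top l)"
    by (simp add: Tl_vanish_def topspace_Tl_top)
  then show ?case by simp
next
  case (insert m M)
  have "Tl_vanish l (insert m M) =
      Tl_vanish l M \<inter> {t \<in> topspace (Tl_top l). t m \<in> {0} \<inter> {0..<int l ^ m}}"
    by (auto simp: Tl_vanish_def topspace_Tl_top Tl_carrier)
  moreover have "openin (Tl_top l) {t \<in> topspace (Tl_top l). t m \<in> {0} \<inter> {0..<int l ^ m}}"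
    by (rule openin_continuous_map_preimage[OF continuous_map_Tl_coordinate]) simp
  ultimately show ?case using insert by (simp add: openin_Int)
qed

text \<open>A basic open box restricts finitely many coordinates; \<open>N\<close> lies above all of
  them.\<close>

lemma product_discrete_neighbourhood:
  fixes B :: "nat \<Rightarrow> 'a set"
  assumes U: "openin (product_topology (\<lambda>k. discrete_topology (B k)) UNIV) U" and t: "t \<in> U"
  obtains N where "\<And>u. (\<And>k. u k \<in> B k) \<Longrightarrow> (\<And>k. k < N \<Longrightarrow> u k = t k) \<Longrightarrow> u \<in> U"
proof -
  obtain V where V: "finite {k. V k \<noteq> B k}" "t \<in> Pi UNIV V" "Pi UNIV V \<subseteq> U"
    using bspec[OF U[unfolded openin_product_topology_alt] t] by (auto simp: PiE_UNIV_domain)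
  obtain N where N: "\<And>k. V k \<noteq> B k \<Longrightarrow> k < N"
    using V(1) unfolding finite_nat_set_iff_bounded by blast
  have "u \<in> U" if u: "\<And>k. u k \<in> B k" "\<And>k. k < N \<Longrightarrow> u k = t k" for u
  proof -
    have "u k \<in> V k" for k
    proof (cases "k < N")
      case True
      then show ?thesis using u(2) V(2) by auto
    next
      case False
      then have "V k = B k" using N by blast
      then show ?thesis using u(1) by simp
    qed
    then show ?thesis using V(3) by auto
  qed
  then show thesis using that by blast
qed

lemma Tl_neighbourhood:
  assumes "openin (Tl_top l) U" "t \<in> U"
  obtains N where "\<And>u. u \<in> carrier (Tl_group l) \<Longrightarrow> (\<And>k. k < N \<Longrightarrow> u k = t k) \<Longrightarrow> u \<in> U"
proof -
  obtain N where "\<And>u. (\<And>k. u k \<in> {0..<int l ^ k}) \<Longrightarrow> (\<And>k. k < N \<Longrightarrow> u k = t k) \<Longrightarrow> u \<in> U"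
    using product_discrete_neighbourhood[OF assms[unfolded Tl_top_def]] by blast
  then show thesis by (intro that[of N]) (simp add: Tl_carrier)
qed

text \<open>Below \<open>N\<close> the modulus \<open>l ^ k\<close> divides \<open>l ^ N\<close>,
  and from \<open>N\<close> on the coordinates are zero.\<close>

lemma Tl_vanish_atLeast_torsion:
  assumes l: "0 < l" and t: "t \<in> Tl_vanish l {N..}"
  shows "t [^]\<^bsub>Tl_group l\<^esub> (l ^ N) = \<one>\<^bsub>Tl_group l\<^esub>"
proof -
  have "(int l ^ N * t k) mod int l ^ k = 0" for k
  proof (cases "k < N")
    case True
    then have "int l ^ k dvd int l ^ N" by (simp add: le_imp_power_dvd)
    then show ?thesis by simp
  next
    case False
    then show ?thesis using t by (simp add: Tl_vanish_def)
  qed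
  then show ?thesis using l by (simp add: Tl_pow Tl_one)
qed

text \<open>Cutting a sequence off at \<open>N\<close> gives a torsion element with the same first
  \<open>N\<close> coordinates, which for suitable \<open>N\<close> lies in a prescribed
  neighbourhood.\<close>

lemma Tl_torsion_dense:
  assumes l: "0 < l"
  shows "Tl_top l closure_of torsion (Tl_group l) = carrier (Tl_group l)"
proof
  show "carrier (Tl_group l) \<subseteq> Tl_top l closure_of torsion (Tl_group l)"
  proof
    fix t assume t: "t \<in> carrier (Tl_group l)"
    show "t \<in> Tl_top l closure_of torsion (Tl_group l)"
      unfolding in_closure_of
    proof (intro conjI allI impI)
      show "t \<in> topspace (Tl_top l)" using t by (simp add: topspace_Tl_top)
    next
      fix U assume "t \<in> U \<and> openin (Tl_top l) U"
      then obtain N where N: "\<And>u. u \<in> carrier (Tl_group l) \<Longrightarrow>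
          (\<And>k. k < N \<Longrightarrow> u k = t k) \<Longrightarrow> u \<in> U"
        using Tl_neighbourhood[of l U t] by blast
      let ?u = "\<lambda>k. if k < N then t k else 0"
      have u: "?u \<in> Tl_vanish l {N..}" using t l by (simp add: Tl_vanish_def Tl_carrier)
      then have "?u \<in> torsion (Tl_group l)"
        using Tl_vanish_atLeast_torsion[OF l u] l
        by (auto simp: torsion_def Tl_vanish_def intro!: exI[of _ "l ^ N"])
      moreover have "?u \<in> U" using N u by (simp add: Tl_vanish_def)
      ultimately show "\<exists>y. y \<in> torsion (Tl_group l) \<and> y \<in> U" by blast
    qed
  qed
qed (metis closure_of_subset_topspace topspace_Tl_top)

section \<open>Topological groups and continuity of homomorphisms\<close>

lemma topological_groupD:
  assumes "topological_group G TG"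
  shows "group G" "topspace TG = carrier G"
    and "continuous_map TG TG (m_inv G)"
    and "continuous_map TX TG f \<Longrightarrow> continuous_map TX TG g \<Longrightarrow>
           continuous_map TX TG (\<lambda>x. f x \<otimes>\<^bsub>G\<^esub> g x)"
proof -
  show "group G" "topspace TG = carrier G" "continuous_map TG TG (m_inv G)"
    using assms by (auto simp: topological_group_def)
  assume "continuous_map TX TG f" "continuous_map TX TG g"
  then have "continuous_map TX (prod_topology TG TG) (\<lambda>x. (f x, g x))"
    by (simp add: continuous_map_pairedI)
  then have "continuous_map TX TG ((\<lambda>(x, y). x \<otimes>\<^bsub>G\<^esub> y) \<circ> (\<lambda>x. (f x, g x)))"
    using assms continuous_map_compose unfolding topological_group_def by blast
  then show "continuous_map TX TG (\<lambda>x. f x \<otimes>\<^bsub>G\<^esub> g x)" by (simp add: comp_def)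
qed

lemma topological_group_continuous_pow:
  assumes "topological_group G TG"
  shows "continuous_map TG TG (\<lambda>x. x [^]\<^bsub>G\<^esub> (n::nat))"
proof (induction n)
  case 0
  interpret group G by (rule topological_groupD(1)[OF assms])
  show ?case using topological_groupD(2)[OF assms] by simp
next
  case (Suc n)
  then show ?case
    using topological_groupD(4)[OF assms Suc continuous_map_id[unfolded id_def]] by simp
qed

text \<open>Translation moves continuity at the identity to any point \<open>x\<close>, through
  \<open>f z = f x \<otimes> f (inv x \<otimes> z)\<close>.\<close>

lemma continuous_map_hom_at_one:
  assumes G: "topological_group G TG" and H: "topological_group H TH" and f: "f \<in> hom G H"
    and one: "\<And>V. openin TH V \<Longrightarrow> \<one>\<^bsub>H\<^esub> \<in> V \<Longrightarrow>
                \<exists>W. openin TG W \<and> \<one>\<^bsub>G\<^esub> \<in> W \<and> f ` W \<subseteq> V"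
  shows "continuous_map TG TH f"
proof -
  interpret G: group G by (rule topological_groupD(1)[OF G])
  interpret H: group H by (rule topological_groupD(1)[OF H])
  interpret f: group_hom G H f by unfold_locales (rule f)
  note tG = topological_groupD(2)[OF G] and tH = topological_groupD(2)[OF H]
  have "openin TG {x \<in> topspace TG. f x \<in> U}" if U: "openin TH U" for U
  proof (subst openin_subopen, intro ballI)
    fix x assume "x \<in> {x \<in> topspace TG. f x \<in> U}"
    then have x: "x \<in> carrier G" "f x \<in> U" by (auto simp: tG)
    have "openin TH {y \<in> topspace TH. f x \<otimes>\<^bsub>H\<^esub> y \<in> U}"
      using x U f.hom_closed
      by (intro openin_continuous_map_preimage[OF topological_groupD(4)[OF H]])
        (auto simp: tH continuous_map_id[unfolded id_def])
    moreover have "\<one>\<^bsub>H\<^esub> \<in> {y \<in> topspace TH. f x \<otimes>\<^bsub>H\<^esub> y \<in> U}"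
      using x f.hom_closed by (auto simp: tH)
    ultimately obtain W where W: "openin TG W" "\<one>\<^bsub>G\<^esub> \<in> W"
      "f ` W \<subseteq> {y \<in> topspace TH. f x \<otimes>\<^bsub>H\<^esub> y \<in> U}"
      using one by metis
    let ?W = "{z \<in> topspace TG. inv\<^bsub>G\<^esub> x \<otimes>\<^bsub>G\<^esub> z \<in> W}"
    have "openin TG ?W"
      using x W
      by (intro openin_continuous_map_preimage[OF topological_groupD(4)[OF G]])
        (auto simp: tG continuous_map_id[unfolded id_def])
    moreover have "x \<in> ?W" using x W by (auto simp: tG)
    moreover have "?W \<subseteq> {x \<in> topspace TG. f x \<in> U}"
    proof
      fix z assume "z \<in> ?W"
      then have z: "z \<in> carrier G" "f (inv\<^bsub>G\<^esub> x \<otimes>\<^bsub>G\<^esub> z) \<in> f ` W" by (auto simp: tG)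
      then have "f x \<otimes>\<^bsub>H\<^esub> f (inv\<^bsub>G\<^esub> x \<otimes>\<^bsub>G\<^esub> z) \<in> U" using W by blast
      moreover have "f x \<otimes>\<^bsub>H\<^esub> f (inv\<^bsub>G\<^esub> x \<otimes>\<^bsub>G\<^esub> z) = f z"
        using x z by (simp add: H.m_assoc[symmetric])
      ultimately show "z \<in> {x \<in> topspace TG. f x \<in> U}" using z by (simp add: tG)
    qed
    ultimately show "\<exists>T. openin TG T \<and> x \<in> T \<and> T \<subseteq> {x \<in> topspace TG. f x \<in> U}" by blast
  qed
  then show ?thesis
    using f.hom_closed by (simp add: continuous_map_def tG tH Pi_iff)
qed

section \<open>Uniqueness\<close>

locale tl_extension = A: group A + D: comm_group D
  for A :: "'a monoid" and D :: "'d monoid" +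
  fixes l :: nat and TG :: "'d topology" and i :: "(nat \<Rightarrow> int) \<Rightarrow> 'd" and p :: "'d \<Rightarrow> 'a"
  assumes l_gt_1: "1 < l"
    and top: "topological_group D TG"
    and compact: "compact_space TG"
    and Hausdorff: "Hausdorff_space TG"
    and i_hom: "i \<in> hom (Tl_group l) D"
    and i_cont: "continuous_map (Tl_top l) TG i"
    and i_inj: "inj_on i (carrier (Tl_group l))"
    and p_hom: "p \<in> hom D A"
    and p_cont: "continuous_map TG (discrete_topology (carrier A)) p"
    and p_surj: "p ` carrier D = carrier A"
    and exact: "i ` carrier (Tl_group l) = kernel D A p"
    and torsion_subset: "torsion D \<subseteq> i ` carrier (Tl_group l)"
begin

sublocale T: comm_group "Tl_group l"
  using Tl_group_comm_group l_gt_1 by simp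

sublocale i: group_hom "Tl_group l" D i
  by unfold_locales (rule i_hom)

sublocale p: group_hom D A p
  by unfold_locales (rule p_hom)

lemma topspace_TG: "topspace TG = carrier D"
  by (rule topological_groupD(2)[OF top])

lemma p_i [simp]: "t \<in> carrier (Tl_group l) \<Longrightarrow> p (i t) = \<one>\<^bsub>A\<^esub>"
  using exact by (auto simp: kernel_def)

lemma p_one_cases:
  assumes "d \<in> carrier D" "p d = \<one>\<^bsub>A\<^esub>"
  obtains t where "t \<in> carrier (Tl_group l)" "d = i t"
  using assms exact by (auto simp: kernel_def)

lemma i_eq_one: "t \<in> carrier (Tl_group l) \<Longrightarrow> i t = \<one>\<^bsub>D\<^esub> \<Longrightarrow> t = (\<lambda>k. 0)"
  using i_inj T.one_closed by (auto simp: inj_on_def Tl_one simp flip: i.hom_one)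

lemma closedin_i_image:
  assumes "closedin (Tl_top l) S"
  shows "closedin TG (i ` S)"
  using compactin_imp_closedin[OF Hausdorff]
    image_compactin[OF closedin_compact_space[OF compact_space_Tl_top assms] i_cont] .

text \<open>The image of \<open>i\<close> is the kernel of \<open>p\<close>, which is open because
  \<open>A\<close> is discrete. Removing the compact, hence closed, image of the complement of
  \<open>S\<close> leaves the image of \<open>S\<close>, by injectivity.\<close>

lemma openin_i_image:
  assumes "openin (Tl_top l) S"
  shows "openin TG (i ` S)"
proof -
  let ?T = "carrier (Tl_group l)"
  have S: "S \<subseteq> ?T" using openin_subset[OF assms] by (simp add: topspace_Tl_top)
  have "openin TG {d \<in> topspace TG. p d \<in> {\<one>\<^bsub>A\<^esub>}}"
    by (rule openin_continuous_map_preimage[OF p_cont]) simp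
  also have "{d \<in> topspace TG. p d \<in> {\<one>\<^bsub>A\<^esub>}} = i ` ?T"
    by (auto simp: exact kernel_def topspace_TG)
  finally have "openin TG (i ` ?T)" .
  moreover have "closedin TG (i ` (?T - S))"
    using assms by (intro closedin_i_image) (metis closedin_def closedin_diff closedin_topspace topspace_Tl_top)
  ultimately have "openin TG (i ` ?T - i ` (?T - S))" by (rule openin_diff)
  also have "i ` ?T - i ` (?T - S) = i ` S"
    using S i_inj by (auto simp: inj_on_def)
  finally show ?thesis .
qed

text \<open>Equivalently, modulo the image of \<open>Tl_vanish l M\<close> every element killed by
  \<open>n\<close> comes from \<open>T_l\<close>. This is what makes a partial character on the
  fibre product well defined later.\<close>

definition detects :: "nat \<Rightarrow> nat set \<Rightarrow> bool" where
  "detects n M \<longleftrightarrow> (\<forall>d\<in>carrier D. \<forall>t\<in>Tl_vanish l M. d [^]\<^bsub>D\<^esub> n = i t \<longrightarrow> p d = \<one>\<^bsub>A\<^esub>)"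

text \<open>If no interval starting at \<open>N\<close> worked, the nested closed sets of
  counterexamples would, by compactness, share some \<open>d\<close>. Its \<open>n\<close>-th power
  would be \<open>i t\<close> with \<open>t\<close> zero from \<open>N\<close> on, hence killed by
  \<open>l ^ N\<close>; so \<open>d\<close> would be torsion outside the kernel of
  \<open>p\<close>.\<close>

lemma detects_interval:
  assumes n: "0 < n"
  obtains N' where "N < N'" "detects n {N..<N'}"
proof -
  let ?T = "carrier (Tl_group l)"
  \<comment> \<open>\<open>Suc k\<close> keeps the interval nonempty, as \<open>N < N'\<close>
    demands.\<close>
  define C where "C k = {d \<in> topspace TG. p d \<in> carrier A - {\<one>\<^bsub>A\<^esub>}} \<inter>
      {d \<in> topspace TG. d [^]\<^bsub>D\<^esub> n \<in> i ` Tl_vanish l {N..<N + Suc k}}" for k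
  have "\<exists>k. C k = {}"
  proof (rule ccontr)
    assume ne: "\<nexists>k. C k = {}"
    have "closedin TG (C k)" for k
      unfolding C_def
      by (intro closedin_Int closedin_continuous_map_preimage[OF p_cont]
          closedin_continuous_map_preimage[OF topological_group_continuous_pow[OF top]]
          closedin_i_image closedin_Tl_vanish) auto
    moreover have "decseq C"
      unfolding decseq_def C_def Tl_vanish_def by fastforce
    ultimately have "(\<Inter>k. C k) \<noteq> {}"
      using ne by (intro compact_space_imp_nest[OF compact]) auto
    then obtain d where d: "d \<in> C k" for k by blast
    then have dD: "d \<in> carrier D" and pd: "p d \<noteq> \<one>\<^bsub>A\<^esub>"
      using d[of 0] by (auto simp: C_def topspace_TG)
    have "\<exists>t\<in>Tl_vanish l {N..<N + Suc k}. d [^]\<^bsub>D\<^esub> n = i t" for k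
      using d[of k] by (auto simp: C_def)
    then obtain t where t: "\<And>k. t k \<in> Tl_vanish l {N..<N + Suc k}" "\<And>k. d [^]\<^bsub>D\<^esub> n = i (t k)"
      by metis
    \<comment> \<open>Injectivity of \<open>i\<close> identifies the witnesses for the different
      intervals, so the single \<open>t 0\<close> vanishes on all of them.\<close>
    have "t k = t 0" for k
      using i_inj t(1)[of k] t(1)[of 0] t(2)[of k] t(2)[of 0]
      by (auto simp: inj_on_def Tl_vanish_def)
    then have t0: "t 0 \<in> Tl_vanish l {N..<N + Suc k}" for k using t(1)[of k] by metis
    have "t 0 m = 0" if "m \<ge> N" for m
      using t0[of m] that by (simp add: Tl_vanish_def)
    then have t0: "t 0 \<in> Tl_vanish l {N..}" using t0[of 0] by (simp add: Tl_vanish_def)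
    have t0T: "t 0 \<in> ?T" using t0 by (simp add: Tl_vanish_def)
    have "d [^]\<^bsub>D\<^esub> (n * l ^ N) = i (t 0) [^]\<^bsub>D\<^esub> (l ^ N)"
      using dD t(2)[of 0] by (simp flip: D.nat_pow_pow)
    also have "\<dots> = \<one>\<^bsub>D\<^esub>"
      using Tl_vanish_atLeast_torsion[OF _ t0] l_gt_1 i.hom_nat_pow[OF t0T, of "l ^ N"] by simp
    finally have "d \<in> torsion D"
      using dD n l_gt_1 by (auto simp: torsion_def intro!: exI[of _ "n * l ^ N"])
    then have "p d = \<one>\<^bsub>A\<^esub>" using torsion_subset by auto
    then show False using pd by simp
  qed
  then obtain k where k: "C k = {}" by blast
  have "detects n {N..<N + Suc k}"
    unfolding detects_def
  proof (intro ballI impI, rule ccontr)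
    fix d t assume "d \<in> carrier D" "t \<in> Tl_vanish l {N..<N + Suc k}"
      "d [^]\<^bsub>D\<^esub> n = i t" "p d \<noteq> \<one>\<^bsub>A\<^esub>"
    then have "d \<in> C k" using p.hom_closed by (auto simp: C_def topspace_TG)
    then show False using k by simp
  qed
  then show thesis using that[of "N + Suc k"] by simp
qed

end

section \<open>The fibre product of two extensions and its characters\<close>

locale two_tl_extensions =
  E: tl_extension A D l TD i p + F: tl_extension A G l TG j s
  for A :: "'a monoid" and l and D :: "'b monoid" and TD i p and G :: "'c monoid" and TG j s
begin

text \<open>The pullback of \<open>p\<close> and \<open>s\<close>. The graph of an isomorphism over
  \<open>A\<close> is a subgroup of it, and its elements over the identity of \<open>A\<close> form
  a copy of the square of \<open>T_l\<close>.\<close>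

definition fibre where
  "fibre = (D \<times>\<times> G)\<lparr>carrier := {(x, y). x \<in> carrier D \<and> y \<in> carrier G \<and> p x = s y}\<rparr>"

lemma fibre_simps [simp]:
  "(x, y) \<in> carrier fibre \<longleftrightarrow> x \<in> carrier D \<and> y \<in> carrier G \<and> p x = s y"
  "(x, y) \<otimes>\<^bsub>fibre\<^esub> (x', y') = (x \<otimes>\<^bsub>D\<^esub> x', y \<otimes>\<^bsub>G\<^esub> y')"
  "\<one>\<^bsub>fibre\<^esub> = (\<one>\<^bsub>D\<^esub>, \<one>\<^bsub>G\<^esub>)"
  by (simp_all add: fibre_def DirProd_def)

sublocale fibre: comm_group fibre
proof (rule comm_groupI)
  fix w assume "w \<in> carrier fibre"
  then obtain x y where w: "w = (x, y)" "x \<in> carrier D" "y \<in> carrier G" "p x = s y"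
    by (cases w) auto
  show "\<exists>v\<in>carrier fibre. v \<otimes>\<^bsub>fibre\<^esub> w = \<one>\<^bsub>fibre\<^esub>"
    using w by (intro bexI[of _ "(inv\<^bsub>D\<^esub> x, inv\<^bsub>G\<^esub> y)"]) simp_all
next
  fix v w assume vw: "v \<in> carrier fibre" "w \<in> carrier fibre"
  then obtain x y x' y' where eq: "v = (x, y)" "w = (x', y')" by (cases v, cases w) auto
  show "v \<otimes>\<^bsub>fibre\<^esub> w \<in> carrier fibre" using vw eq by simp
  show "v \<otimes>\<^bsub>fibre\<^esub> w = w \<otimes>\<^bsub>fibre\<^esub> v"
    using vw eq E.D.m_comm F.D.m_comm by simp
next
  fix u v w assume uvw: "u \<in> carrier fibre" "v \<in> carrier fibre" "w \<in> carrier fibre"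
  obtain x y x' y' x'' y'' where eq: "u = (x, y)" "v = (x', y')" "w = (x'', y'')"
    by (cases u, cases v, cases w) auto
  show "u \<otimes>\<^bsub>fibre\<^esub> v \<otimes>\<^bsub>fibre\<^esub> w = u \<otimes>\<^bsub>fibre\<^esub> (v \<otimes>\<^bsub>fibre\<^esub> w)"
    using uvw by (simp add: eq E.D.m_assoc F.D.m_assoc)
qed (auto simp: split_paired_all)

lemma fibre_inv:
  assumes "(x, y) \<in> carrier fibre"
  shows "inv\<^bsub>fibre\<^esub> (x, y) = (inv\<^bsub>D\<^esub> x, inv\<^bsub>G\<^esub> y)"
  using assms by (intro fibre.inv_equality) simp_all

lemma fibre_pow:
  assumes "(x, y) \<in> carrier fibre"
  shows "(x, y) [^]\<^bsub>fibre\<^esub> (n::nat) = (x [^]\<^bsub>D\<^esub> n, y [^]\<^bsub>G\<^esub> n)"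
  by (induction n) simp_all

text \<open>The partial character takes \<open>(i t, j u)\<close> times an \<open>l ^ k\<close>-th
  power to \<open>u k - t k\<close>. If such a product is the identity, detection forces the
  components of the base of the power into the two copies of \<open>T_l\<close>. There
  \<open>l ^ k\<close>-th powers vanish in coordinate \<open>k\<close>, so \<open>t k\<close> and
  \<open>u k\<close> are zero modulo \<open>l ^ k\<close>.\<close>

lemma coordinate_extension:
  assumes M: "E.detects (l ^ k) M"
  obtains h where
    "\<And>v w. v \<in> carrier fibre \<Longrightarrow> w \<in> carrier fibre \<Longrightarrow> int l ^ k dvd h (v \<otimes>\<^bsub>fibre\<^esub> w) - h v - h w"
    and "\<And>t u. t \<in> Tl_vanish l M \<Longrightarrow> u \<in> carrier (Tl_group l) \<Longrightarrow>
           int l ^ k dvd h (i t, j u) - (u k - t k)"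
proof -
  let ?T = "carrier (Tl_group l)"
  define q where "q = int l ^ k"
  have q: "0 < q" using E.l_gt_1 by (simp add: q_def)
  \<comment> \<open>The powers of all \<open>v\<close> are included, contributing value zero, as
    \<open>extend_mod_graph\<close> requires.\<close>
  define R where "R = {((i t, j u) \<otimes>\<^bsub>fibre\<^esub> (v [^]\<^bsub>fibre\<^esub> (l ^ k)), z) | t u v z.
      t \<in> Tl_vanish l M \<and> u \<in> ?T \<and> v \<in> carrier fibre \<and> q dvd z - (u k - t k)}"
  have RI: "t \<in> Tl_vanish l M \<Longrightarrow> u \<in> ?T \<Longrightarrow> v \<in> carrier fibre \<Longrightarrow> q dvd z - (u k - t k) \<Longrightarrow>
      w = (i t, j u) \<otimes>\<^bsub>fibre\<^esub> (v [^]\<^bsub>fibre\<^esub> (l ^ k)) \<Longrightarrow> (w, z) \<in> R" for t u v w z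
    unfolding R_def by blast
  have vT: "t \<in> Tl_vanish l M \<Longrightarrow> t \<in> ?T" for t by (simp add: Tl_vanish_def)
  have base: "(i t, j u) \<in> carrier fibre" if "t \<in> ?T" "u \<in> ?T" for t u
    using that by simp
  have zero: "(\<lambda>k. 0) \<in> Tl_vanish l M" "(\<lambda>k. 0) \<in> ?T"
    using E.l_gt_1 by (simp_all add: Tl_vanish_def Tl_carrier)
  have i0: "i (\<lambda>k. 0) = \<one>\<^bsub>D\<^esub>" and j0: "j (\<lambda>k. 0) = \<one>\<^bsub>G\<^esub>"
    using E.i.hom_one F.i.hom_one by (simp_all add: Tl_one)
  have swap: "(a \<otimes>\<^bsub>fibre\<^esub> b) \<otimes>\<^bsub>fibre\<^esub> (c \<otimes>\<^bsub>fibre\<^esub> d) =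
      (a \<otimes>\<^bsub>fibre\<^esub> c) \<otimes>\<^bsub>fibre\<^esub> (b \<otimes>\<^bsub>fibre\<^esub> d)"
    if "a \<in> carrier fibre" "b \<in> carrier fibre" "c \<in> carrier fibre" "d \<in> carrier fibre" for a b c d
    using that by (simp only: fibre.m_ac fibre.m_closed)
  have "mod_graph fibre q R"
    unfolding mod_graph_def
  proof (intro conjI allI impI)
    show "R \<subseteq> carrier fibre \<times> UNIV"
    proof
      fix x assume "x \<in> R"
      then obtain t u v z where "t \<in> Tl_vanish l M" "u \<in> ?T" "v \<in> carrier fibre"
        "x = ((i t, j u) \<otimes>\<^bsub>fibre\<^esub> (v [^]\<^bsub>fibre\<^esub> (l ^ k)), z)" unfolding R_def by blast
      then show "x \<in> carrier fibre \<times> UNIV"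
        using fibre.m_closed[OF base fibre.nat_pow_closed] vT by blast
    qed
  next
    fix x a y b assume "(x, a) \<in> R" "(y, b) \<in> R"
    then obtain t u v t' u' v' where *:
      "t \<in> Tl_vanish l M" "u \<in> ?T" "v \<in> carrier fibre" "q dvd a - (u k - t k)"
      "x = (i t, j u) \<otimes>\<^bsub>fibre\<^esub> (v [^]\<^bsub>fibre\<^esub> (l ^ k))"
      "t' \<in> Tl_vanish l M" "u' \<in> ?T" "v' \<in> carrier fibre" "q dvd b - (u' k - t' k)"
      "y = (i t', j u') \<otimes>\<^bsub>fibre\<^esub> (v' [^]\<^bsub>fibre\<^esub> (l ^ k))"
      unfolding R_def by blast
    show "(x \<otimes>\<^bsub>fibre\<^esub> y, a + b) \<in> R"
    proof (rule RI)
      show "t \<otimes>\<^bsub>Tl_group l\<^esub> t' \<in> Tl_vanish l M"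
        using * E.T.m_closed by (auto simp: Tl_vanish_def Tl_mult)
      show uu: "u \<otimes>\<^bsub>Tl_group l\<^esub> u' \<in> ?T" using * by simp
      show vv: "v \<otimes>\<^bsub>fibre\<^esub> v' \<in> carrier fibre" by (rule fibre.m_closed[OF *(3,8)])
      \<comment> \<open>Multiplication in \<open>T_l\<close> reduces coordinate \<open>k\<close>
        modulo \<open>l ^ k\<close>; the two reductions change the sum by multiples of
        \<open>q\<close>.\<close>
      have "q dvd (a - (u k - t k)) + (b - (u' k - t' k)) - ((u k + u' k) mod q - (u k + u' k))
          + ((t k + t' k) mod q - (t k + t' k))"
        by (rule dvd_add[OF dvd_diff[OF dvd_add[OF *(4,9)] dvd_mod_diff] dvd_mod_diff])
      then show "q dvd a + b - ((u \<otimes>\<^bsub>Tl_group l\<^esub> u') k - (t \<otimes>\<^bsub>Tl_group l\<^esub> t') k)"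
        by (simp add: Tl_mult q_def algebra_simps)
      have "(i (t \<otimes>\<^bsub>Tl_group l\<^esub> t'), j (u \<otimes>\<^bsub>Tl_group l\<^esub> u')) = (i t, j u) \<otimes>\<^bsub>fibre\<^esub> (i t', j u')"
        using * vT by simp
      then show "x \<otimes>\<^bsub>fibre\<^esub> y = (i (t \<otimes>\<^bsub>Tl_group l\<^esub> t'), j (u \<otimes>\<^bsub>Tl_group l\<^esub> u')) \<otimes>\<^bsub>fibre\<^esub>
          ((v \<otimes>\<^bsub>fibre\<^esub> v') [^]\<^bsub>fibre\<^esub> (l ^ k))"
        unfolding *(5,10) fibre.nat_pow_distrib[OF *(3,8)]
        using swap[OF base[OF vT[OF *(1)] *(2)] fibre.nat_pow_closed[OF *(3)]
            base[OF vT[OF *(6)] *(7)] fibre.nat_pow_closed[OF *(8)]] by metis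
    qed
  next
    fix x a assume "(x, a) \<in> R"
    then obtain t u v where *:
      "t \<in> Tl_vanish l M" "u \<in> ?T" "v \<in> carrier fibre" "q dvd a - (u k - t k)"
      "x = (i t, j u) \<otimes>\<^bsub>fibre\<^esub> (v [^]\<^bsub>fibre\<^esub> (l ^ k))"
      unfolding R_def by blast
    let ?t = "\<lambda>k. (- t k) mod int l ^ k" and ?u = "\<lambda>k. (- u k) mod int l ^ k"
    have inv: "?t \<in> ?T" "?u \<in> ?T" using E.l_gt_1 by (simp_all add: Tl_carrier)
    have it: "i ?t = inv\<^bsub>D\<^esub> i t"
    proof (rule E.D.inv_equality[symmetric])
      have "?t \<otimes>\<^bsub>Tl_group l\<^esub> t = \<one>\<^bsub>Tl_group l\<^esub>" by (simp add: Tl_mult Tl_one mod_simps)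
      then show "i ?t \<otimes>\<^bsub>D\<^esub> i t = \<one>\<^bsub>D\<^esub>"
        using E.i.hom_mult[OF inv(1) vT[OF *(1)]] by simp
    qed (use inv * vT in auto)
    have ju: "j ?u = inv\<^bsub>G\<^esub> j u"
    proof (rule F.D.inv_equality[symmetric])
      have "?u \<otimes>\<^bsub>Tl_group l\<^esub> u = \<one>\<^bsub>Tl_group l\<^esub>" by (simp add: Tl_mult Tl_one mod_simps)
      then show "j ?u \<otimes>\<^bsub>G\<^esub> j u = \<one>\<^bsub>G\<^esub>"
        using F.i.hom_mult[OF inv(2) *(2)] by simp
    qed (use inv * vT in auto)
    show "(inv\<^bsub>fibre\<^esub> x, - a) \<in> R"
    proof (rule RI)
      show "?t \<in> Tl_vanish l M" using inv * by (simp add: Tl_vanish_def)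
      show "?u \<in> ?T" by (rule inv)
      show "inv\<^bsub>fibre\<^esub> v \<in> carrier fibre" using * by simp
      have "q dvd - (a - (u k - t k)) - ((- u k) mod q - (- u k)) + ((- t k) mod q - (- t k))"
        by (rule dvd_add[OF dvd_diff[OF dvd_minus_iff[THEN iffD2, OF *(4)] dvd_mod_diff] dvd_mod_diff])
      then show "q dvd - a - (?u k - ?t k)"
        by (simp add: q_def algebra_simps)
      have "(i ?t, j ?u) = inv\<^bsub>fibre\<^esub> (i t, j u)"
        using it ju fibre_inv[OF base[OF vT[OF *(1)] *(2)]] by simp
      then show "inv\<^bsub>fibre\<^esub> x = (i ?t, j ?u) \<otimes>\<^bsub>fibre\<^esub> ((inv\<^bsub>fibre\<^esub> v) [^]\<^bsub>fibre\<^esub> (l ^ k))"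
        unfolding *(5) fibre.inv_mult[OF base[OF vT[OF *(1)] *(2)] fibre.nat_pow_closed[OF *(3)]]
          fibre.nat_pow_inv[OF *(3)] by metis
    qed
  next
    fix a assume "(\<one>\<^bsub>fibre\<^esub>, a) \<in> R"
    then obtain t u v where *:
      "t \<in> Tl_vanish l M" "u \<in> ?T" "v \<in> carrier fibre" "q dvd a - (u k - t k)"
      and eq: "\<one>\<^bsub>fibre\<^esub> = (i t, j u) \<otimes>\<^bsub>fibre\<^esub> (v [^]\<^bsub>fibre\<^esub> (l ^ k))"
      unfolding R_def by blast
    obtain x y where v: "v = (x, y)" by (cases v)
    have xy: "x \<in> carrier D" "y \<in> carrier G" "p x = s y" using * v by auto
    have eqs: "i t \<otimes>\<^bsub>D\<^esub> x [^]\<^bsub>D\<^esub> (l ^ k) = \<one>\<^bsub>D\<^esub>" "j u \<otimes>\<^bsub>G\<^esub> y [^]\<^bsub>G\<^esub> (l ^ k) = \<one>\<^bsub>G\<^esub>"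
      using eq v * fibre_pow[of x y] by simp_all
    \<comment> \<open>The inverse of \<open>x\<close> has \<open>l ^ k\<close>-th power
      \<open>i t\<close>, so detection applies to it; \<open>p x = s y\<close> then passes the
      conclusion on to \<open>y\<close>.\<close>
    have "i t = inv\<^bsub>D\<^esub> (x [^]\<^bsub>D\<^esub> (l ^ k))"
      using E.D.inv_equality[OF eqs(1)] xy vT[OF *(1)] by simp
    then have "(inv\<^bsub>D\<^esub> x) [^]\<^bsub>D\<^esub> (l ^ k) = i t"
      using E.D.nat_pow_inv[OF xy(1)] by simp
    then have "p (inv\<^bsub>D\<^esub> x) = \<one>\<^bsub>A\<^esub>"
      using M * xy unfolding E.detects_def by (metis E.D.inv_closed)
    then have px: "p x = \<one>\<^bsub>A\<^esub>" using xy by simp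
    obtain t' where t': "t' \<in> ?T" "x = i t'" using E.p_one_cases[OF xy(1) px] .
    obtain u' where u': "u' \<in> ?T" "y = j u'" using F.p_one_cases[of y] px xy by metis
    have "i (t \<otimes>\<^bsub>Tl_group l\<^esub> t' [^]\<^bsub>Tl_group l\<^esub> (l ^ k)) = \<one>\<^bsub>D\<^esub>"
      using eqs(1) t' vT[OF *(1)] by (simp add: E.i.hom_nat_pow)
    then have t0: "t \<otimes>\<^bsub>Tl_group l\<^esub> t' [^]\<^bsub>Tl_group l\<^esub> (l ^ k) = (\<lambda>k. 0)"
      using t' vT[OF *(1)] by (intro E.i_eq_one) auto
    have "t k mod int l ^ k = 0"
      using fun_cong[OF t0, of k] E.l_gt_1 by (simp add: Tl_mult Tl_pow)
    then have tk: "q dvd t k" by (simp add: q_def dvd_eq_mod_eq_0)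
    have "j (u \<otimes>\<^bsub>Tl_group l\<^esub> u' [^]\<^bsub>Tl_group l\<^esub> (l ^ k)) = \<one>\<^bsub>G\<^esub>"
      using eqs(2) u' *(2) by (simp add: F.i.hom_nat_pow)
    then have u0: "u \<otimes>\<^bsub>Tl_group l\<^esub> u' [^]\<^bsub>Tl_group l\<^esub> (l ^ k) = (\<lambda>k. 0)"
      using u' *(2) by (intro F.i_eq_one) auto
    have "u k mod int l ^ k = 0"
      using fun_cong[OF u0, of k] E.l_gt_1 by (simp add: Tl_mult Tl_pow)
    then have uk: "q dvd u k" by (simp add: q_def dvd_eq_mod_eq_0)
    have "q dvd a - (u k - t k) + (u k - t k)"
      by (rule dvd_add[OF *(4) dvd_diff[OF uk tk]])
    then show "q dvd a" by simp
  qed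
  moreover have "(v [^]\<^bsub>fibre\<^esub> q, 0) \<in> R" if "v \<in> carrier fibre" for v
  proof (rule RI[OF zero that])
    have "v [^]\<^bsub>fibre\<^esub> q = v [^]\<^bsub>fibre\<^esub> (l ^ k)"
      unfolding q_def by (metis int_pow_int of_nat_power)
    then show "v [^]\<^bsub>fibre\<^esub> q = (i (\<lambda>k. 0), j (\<lambda>k. 0)) \<otimes>\<^bsub>fibre\<^esub> (v [^]\<^bsub>fibre\<^esub> (l ^ k))"
      using i0 j0 that fibre.l_one[OF fibre.nat_pow_closed[OF that]] by simp
  qed simp
  ultimately obtain h where
    h: "\<And>v w. v \<in> carrier fibre \<Longrightarrow> w \<in> carrier fibre \<Longrightarrow> q dvd h (v \<otimes>\<^bsub>fibre\<^esub> w) - h v - h w"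
    and hR: "\<And>w z. (w, z) \<in> R \<Longrightarrow> q dvd h w - z"
    using fibre.extend_mod_graph[OF _ q] by metis
  show thesis
  proof (rule that[of h])
    fix t u assume tu: "t \<in> Tl_vanish l M" "u \<in> ?T"
    have "((i t, j u), u k - t k) \<in> R"
    proof (rule RI[OF tu fibre.one_closed])
      show "(i t, j u) = (i t, j u) \<otimes>\<^bsub>fibre\<^esub> (\<one>\<^bsub>fibre\<^esub> [^]\<^bsub>fibre\<^esub> (l ^ k))"
        using fibre.r_one[OF base[OF vT[OF tu(1)] tu(2)]] by (simp only: fibre.nat_pow_one)
    qed simp
    then show "int l ^ k dvd h (i t, j u) - (u k - t k)" using hR by (simp add: q_def)
  qed (use h q_def in blast)
qed

end

section \<open>Gluing the characters into a topological isomorphism\<close>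

context two_tl_extensions
begin

text \<open>The position of \<open>M k\<close> makes the conditions \<open>h k = 0\<close>
  triangular. When \<open>t\<close> is zero, those with \<open>k\<close> outside \<open>S\<close>
  make \<open>u\<close> vanish off \<open>S\<close>, in particular on \<open>M k\<close> for
  \<open>k\<close> in \<open>S\<close>; the remaining conditions then make \<open>u\<close> vanish
  on \<open>S\<close>. Interchanging \<open>t\<close> and \<open>u\<close> replaces \<open>S\<close>
  by its complement.\<close>

definition gluing :: "nat set \<Rightarrow> (nat \<Rightarrow> nat set) \<Rightarrow> (nat \<Rightarrow> 'b \<times> 'c \<Rightarrow> int) \<Rightarrow> bool" where
  "gluing S M h \<longleftrightarrow> (\<forall>k. finite (M k) \<and>
     (\<forall>v\<in>carrier fibre. \<forall>w\<in>carrier fibre. int l ^ k dvd h k (v \<otimes>\<^bsub>fibre\<^esub> w) - h k v - h k w) \<and>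
     (k \<notin> S \<longrightarrow> M k \<subseteq> S \<and> (\<forall>t\<in>Tl_vanish l (M k). \<forall>u\<in>carrier (Tl_group l).
        int l ^ k dvd h k (i t, j u) - (u k - t k))) \<and>
     (k \<in> S \<longrightarrow> M k \<subseteq> - S \<and> (\<forall>t\<in>carrier (Tl_group l). \<forall>u\<in>Tl_vanish l (M k).
        int l ^ k dvd h k (i t, j u) - (u k - t k))))"

text \<open>The common kernel of the characters; for a gluing it is the graph of a bijection from
  \<open>D\<close> to \<open>G\<close>.\<close>

definition graph :: "(nat \<Rightarrow> 'b \<times> 'c \<Rightarrow> int) \<Rightarrow> ('b \<times> 'c) set" where
  "graph h = {w \<in> carrier fibre. \<forall>k. int l ^ k dvd h k w}"

lemma gluingD:
  assumes "gluing S M h"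
  shows "finite (M k)"
    and "v \<in> carrier fibre \<Longrightarrow> w \<in> carrier fibre \<Longrightarrow>
           int l ^ k dvd h k (v \<otimes>\<^bsub>fibre\<^esub> w) - h k v - h k w"
    and "k \<notin> S \<Longrightarrow> M k \<subseteq> S"
    and "k \<in> S \<Longrightarrow> M k \<subseteq> - S"
    and "k \<notin> S \<Longrightarrow> t \<in> Tl_vanish l (M k) \<Longrightarrow> u \<in> carrier (Tl_group l) \<Longrightarrow>
           int l ^ k dvd h k (i t, j u) - (u k - t k)"
    and "k \<in> S \<Longrightarrow> t \<in> carrier (Tl_group l) \<Longrightarrow> u \<in> Tl_vanish l (M k) \<Longrightarrow>
           int l ^ k dvd h k (i t, j u) - (u k - t k)"
  using assms unfolding gluing_def by blast+

text \<open>Existence and uniqueness for the interchanged pair give surjectivity and injectivity of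
  the map from \<open>D\<close> to \<open>G\<close>.\<close>

lemma swapped: "two_tl_extensions A l G TG j s D TD i p"
  by unfold_locales

lemma graph_closed:
  assumes gl: "gluing S M h"
  shows "v \<in> graph h \<Longrightarrow> w \<in> graph h \<Longrightarrow> v \<otimes>\<^bsub>fibre\<^esub> w \<in> graph h"
    and "v \<in> graph h \<Longrightarrow> inv\<^bsub>fibre\<^esub> v \<in> graph h"
proof -
  have sum: "int l ^ k dvd h k (v \<otimes>\<^bsub>fibre\<^esub> w) - h k v - h k w"
    if "v \<in> carrier fibre" "w \<in> carrier fibre" for k v w
    by (rule gluingD(2)[OF gl that])
  {
    assume vw: "v \<in> graph h" "w \<in> graph h"
    then have c: "v \<in> carrier fibre" "w \<in> carrier fibre" by (simp_all add: graph_def)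
    have "int l ^ k dvd h k (v \<otimes>\<^bsub>fibre\<^esub> w)" for k
    proof -
      have "int l ^ k dvd (h k (v \<otimes>\<^bsub>fibre\<^esub> w) - h k v - h k w) + (h k v + h k w)"
        using vw by (intro dvd_add[OF sum[OF c]] dvd_add) (simp_all add: graph_def)
      then show ?thesis by simp
    qed
    then show "v \<otimes>\<^bsub>fibre\<^esub> w \<in> graph h" using fibre.m_closed[OF c] by (simp add: graph_def)
  }
  {
    assume v: "v \<in> graph h"
    then have c: "v \<in> carrier fibre" by (simp add: graph_def)
    have "int l ^ k dvd h k (inv\<^bsub>fibre\<^esub> v)" for k
    proof -
      have one: "int l ^ k dvd h k \<one>\<^bsub>fibre\<^esub>"
        using sum[OF fibre.one_closed fibre.one_closed, of k]
          fibre.l_one[OF fibre.one_closed] by simp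
      have "int l ^ k dvd h k \<one>\<^bsub>fibre\<^esub> - h k v - h k (inv\<^bsub>fibre\<^esub> v)"
        using sum[OF c fibre.inv_closed[OF c], of k] by (simp only: fibre.r_inv[OF c])
      moreover have "int l ^ k dvd h k v" using v by (simp add: graph_def)
      ultimately show ?thesis using dvd_diff[OF dvd_diff[OF one]] by fastforce
    qed
    then show "inv\<^bsub>fibre\<^esub> v \<in> graph h" using fibre.inv_closed[OF c] by (simp add: graph_def)
  }
qed

lemma Tl_coordinate_eq_zero:
  "t \<in> carrier (Tl_group l) \<Longrightarrow> int l ^ k dvd t k \<Longrightarrow> t k = 0"
  unfolding Tl_carrier by (metis dvd_imp_mod_0 mod_pos_pos_trivial)

text \<open>Any \<open>y0\<close> over \<open>p x\<close> is corrected twice: first by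
  \<open>j u\<close> with \<open>u\<close> supported off \<open>S\<close>, then by
  \<open>j v\<close> with \<open>v\<close> supported on \<open>S\<close>. The second correction does
  not disturb the conditions for \<open>k\<close> outside \<open>S\<close>.\<close>

lemma graph_exists:
  assumes gl: "gluing S M h" and x: "x \<in> carrier D"
  shows "\<exists>y. (x, y) \<in> graph h"
proof -
  let ?T = "carrier (Tl_group l)"
  have "p x \<in> s ` carrier G" using x F.p_surj by simp
  then obtain y0 where y0: "y0 \<in> carrier G" "p x = s y0" by auto
  then have xy0: "(x, y0) \<in> carrier fibre" using x by simp
  define u where "u k = (if k \<in> S then 0 else (- h k (x, y0)) mod int l ^ k)" for k
  \<comment> \<open>\<open>v\<close> also has to absorb \<open>h k (\<one>, j u)\<close>: for
    \<open>k\<close> in \<open>S\<close> the gluing gives no formula for this value, since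
    \<open>u\<close> need not vanish on \<open>M k\<close>.\<close>
  define v where "v k = (if k \<in> S then (- h k (x, y0) - h k (\<one>\<^bsub>D\<^esub>, j u)) mod int l ^ k else 0)" for k
  have u: "u \<in> ?T" and v: "v \<in> ?T"
    using E.l_gt_1 by (simp_all add: Tl_carrier u_def v_def)
  have fu: "(\<one>\<^bsub>D\<^esub>, j u) \<in> carrier fibre" and fv: "(\<one>\<^bsub>D\<^esub>, j v) \<in> carrier fibre"
    using u v by simp_all
  have zero: "(\<lambda>k. 0) \<in> Tl_vanish l N" for N
    using E.l_gt_1 by (simp add: Tl_vanish_def Tl_carrier)
  have i0: "i (\<lambda>k. 0) = \<one>\<^bsub>D\<^esub>" using E.i.hom_one by (simp add: Tl_one)
  have "int l ^ k dvd h k ((x, y0) \<otimes>\<^bsub>fibre\<^esub> ((\<one>\<^bsub>D\<^esub>, j u) \<otimes>\<^bsub>fibre\<^esub> (\<one>\<^bsub>D\<^esub>, j v)))" for k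
  proof -
    let ?w = "(\<one>\<^bsub>D\<^esub>, j u) \<otimes>\<^bsub>fibre\<^esub> (\<one>\<^bsub>D\<^esub>, j v)"
    have w: "?w \<in> carrier fibre" by (rule fibre.m_closed[OF fu fv])
    have a: "int l ^ k dvd h k ((x, y0) \<otimes>\<^bsub>fibre\<^esub> ?w) - h k (x, y0) - h k ?w"
      by (rule gluingD(2)[OF gl xy0 w])
    have b: "int l ^ k dvd h k ?w + h k (x, y0)"
    proof (cases "k \<in> S")
      case True
      \<comment> \<open>\<open>v\<close> is supported on \<open>S\<close> and \<open>M k\<close>
        avoids \<open>S\<close>, so \<open>h k (\<one>, j v)\<close> is \<open>v k\<close> modulo
        \<open>l ^ k\<close>.\<close>
      have "v \<in> Tl_vanish l (M k)"
        using gluingD(4)[OF gl True] v by (auto simp: Tl_vanish_def v_def)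
      then have "int l ^ k dvd h k (\<one>\<^bsub>D\<^esub>, j v) - v k"
        using gluingD(6)[OF gl True, of "\<lambda>k. 0" v] zero[of "{}"] i0 by (simp add: Tl_vanish_def)
      moreover have "int l ^ k dvd v k - (- h k (x, y0) - h k (\<one>\<^bsub>D\<^esub>, j u))"
        unfolding v_def if_P[OF True] by (rule dvd_mod_diff)
      moreover have "int l ^ k dvd h k ?w - h k (\<one>\<^bsub>D\<^esub>, j u) - h k (\<one>\<^bsub>D\<^esub>, j v)"
        by (rule gluingD(2)[OF gl fu fv])
      ultimately have "int l ^ k dvd (h k ?w - h k (\<one>\<^bsub>D\<^esub>, j u) - h k (\<one>\<^bsub>D\<^esub>, j v))
          + (h k (\<one>\<^bsub>D\<^esub>, j v) - v k) + (v k - (- h k (x, y0) - h k (\<one>\<^bsub>D\<^esub>, j u)))"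
        by (meson dvd_add)
      then show ?thesis by simp
    next
      case False
      let ?uv = "u \<otimes>\<^bsub>Tl_group l\<^esub> v"
      \<comment> \<open>With first component \<open>i 0\<close> the formula for \<open>k\<close>
        outside \<open>S\<close> holds for every second component, so both corrections are evaluated
        at once, and \<open>v k = 0\<close>.\<close>
      have w_eq: "?w = (i (\<lambda>k. 0), j ?uv)" using u v i0 by simp
      have "int l ^ k dvd h k ?w - ?uv k"
        using gluingD(5)[OF gl False zero E.T.m_closed[OF u v]] by (simp only: w_eq diff_0_right)
      moreover have "?uv k = (- h k (x, y0)) mod int l ^ k"
        using False by (simp add: Tl_mult u_def v_def)
      moreover have "int l ^ k dvd (- h k (x, y0)) mod int l ^ k - (- h k (x, y0))"
        by (rule dvd_mod_diff)
      ultimately have "int l ^ k dvd (h k ?w - ?uv k) + (?uv k - (- h k (x, y0)))"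
        by (metis dvd_add)
      then show ?thesis by simp
    qed
    have "int l ^ k dvd (h k ((x, y0) \<otimes>\<^bsub>fibre\<^esub> ?w) - h k (x, y0) - h k ?w) + (h k ?w + h k (x, y0))"
      by (rule dvd_add[OF a b])
    then show ?thesis by simp
  qed
  then have "(x, y0) \<otimes>\<^bsub>fibre\<^esub> ((\<one>\<^bsub>D\<^esub>, j u) \<otimes>\<^bsub>fibre\<^esub> (\<one>\<^bsub>D\<^esub>, j v)) \<in> graph h"
    using fibre.m_closed[OF xy0 fibre.m_closed[OF fu fv]] by (simp only: graph_def) simp
  then show ?thesis using x by auto
qed

text \<open>On the graph, whenever the formula for \<open>h k\<close> applies, \<open>l ^ k\<close>
  divides \<open>u k - t k\<close>. With \<open>t k = 0\<close> and \<open>u k\<close> a reduced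
  residue this forces \<open>u k = 0\<close>.\<close>

lemma graph_coordinates:
  assumes gl: "gluing S M h" and g: "(i t, j u) \<in> graph h"
    and t: "t \<in> carrier (Tl_group l)" and u: "u \<in> carrier (Tl_group l)"
  shows "k \<notin> S \<Longrightarrow> t \<in> Tl_vanish l (insert k (M k)) \<Longrightarrow> u k = 0"
    and "k \<in> S \<Longrightarrow> u \<in> Tl_vanish l (M k) \<Longrightarrow> t k = 0 \<Longrightarrow> u k = 0"
proof -
  have d: "int l ^ k dvd h k (i t, j u)" using g by (simp add: graph_def)
  {
    assume k: "k \<notin> S" and tv: "t \<in> Tl_vanish l (insert k (M k))"
    have "int l ^ k dvd h k (i t, j u) - (u k - t k)"
      using tv by (intro gluingD(5)[OF gl k _ u]) (simp add: Tl_vanish_def)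
    then have "int l ^ k dvd u k"
      using dvd_diff[OF d, of "h k (i t, j u) - (u k - t k)"] tv by (simp add: Tl_vanish_def)
    then show "u k = 0" by (rule Tl_coordinate_eq_zero[OF u])
  }
  {
    assume k: "k \<in> S" and uv: "u \<in> Tl_vanish l (M k)" and tk: "t k = 0"
    have "int l ^ k dvd h k (i t, j u) - (u k - t k)"
      by (rule gluingD(6)[OF gl k t uv])
    then have "int l ^ k dvd u k"
      using dvd_diff[OF d, of "h k (i t, j u) - (u k - t k)"] tk by simp
    then show "u k = 0" by (rule Tl_coordinate_eq_zero[OF u])
  }
qed

text \<open>The quotient of two graph elements over the same \<open>x\<close> has the form
  \<open>(\<one>, j u)\<close>. The coordinates of \<open>u\<close> off \<open>S\<close> vanish
  first and then, as \<open>M k\<close> lies off \<open>S\<close> for \<open>k\<close> in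
  \<open>S\<close>, those on \<open>S\<close>.\<close>

lemma graph_unique:
  assumes gl: "gluing S M h" and xy: "(x, y) \<in> graph h" "(x, y') \<in> graph h"
  shows "y = y'"
proof -
  let ?T = "carrier (Tl_group l)"
  have c: "(x, y) \<in> carrier fibre" "(x, y') \<in> carrier fibre" using xy by (simp_all add: graph_def)
  have "(x, y) \<otimes>\<^bsub>fibre\<^esub> inv\<^bsub>fibre\<^esub> (x, y') \<in> graph h"
    by (intro graph_closed[OF gl] xy)
  then have g: "(\<one>\<^bsub>D\<^esub>, y \<otimes>\<^bsub>G\<^esub> inv\<^bsub>G\<^esub> y') \<in> graph h"
    using c fibre_inv[OF c(2)] by simp
  then have "y \<otimes>\<^bsub>G\<^esub> inv\<^bsub>G\<^esub> y' \<in> carrier G" "s (y \<otimes>\<^bsub>G\<^esub> inv\<^bsub>G\<^esub> y') = \<one>\<^bsub>A\<^esub>"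
    using c by (simp_all add: graph_def)
  then obtain u where u: "u \<in> ?T" "y \<otimes>\<^bsub>G\<^esub> inv\<^bsub>G\<^esub> y' = j u"
    using F.p_one_cases by metis
  have zero: "(\<lambda>k. 0) \<in> Tl_vanish l N" "(\<lambda>k. 0) \<in> ?T" for N
    using E.l_gt_1 by (simp_all add: Tl_vanish_def Tl_carrier)
  have "(i (\<lambda>k. 0), j u) \<in> graph h"
    using g u E.i.hom_one by (simp add: Tl_one)
  note coords = graph_coordinates[OF gl this zero(2) u(1)]
  have u1: "u k = 0" if "k \<notin> S" for k by (rule coords(1)[OF that zero(1)])
  have "u k = 0" for k
  proof (cases "k \<in> S")
    case True
    have "u \<in> Tl_vanish l (M k)" using gluingD(4)[OF gl True] u u1 by (auto simp: Tl_vanish_def)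
    then show ?thesis by (intro coords(2)[OF True]) simp_all
  qed (rule u1)
  then have "u = \<one>\<^bsub>Tl_group l\<^esub>" by (simp add: Tl_one ext)
  then have "y \<otimes>\<^bsub>G\<^esub> inv\<^bsub>G\<^esub> y' = \<one>\<^bsub>G\<^esub>"
    using u F.i.hom_one by metis
  moreover have yG: "y \<in> carrier G" "y' \<in> carrier G" using c by simp_all
  ultimately have "inv\<^bsub>G\<^esub> (inv\<^bsub>G\<^esub> y') = y"
    using F.D.inv_equality[of y "inv\<^bsub>G\<^esub> y'"] F.D.inv_closed[of y'] by blast
  then show ?thesis using yG by simp
qed

text \<open>Back substitution has depth two, so finitely many coordinates of \<open>t\<close>
  control the first \<open>N\<close> coordinates of \<open>u\<close>. This gives continuity at the
  identity.\<close>

lemma graph_functional_at_one: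
  assumes gl: "gluing S M h"
  obtains W where "finite W" and
    "\<And>t u k. (i t, j u) \<in> graph h \<Longrightarrow> t \<in> Tl_vanish l W \<Longrightarrow> u \<in> carrier (Tl_group l) \<Longrightarrow>
       k < N \<Longrightarrow> u k = 0"
proof -
  define L where "L k = insert k (M k)" for k
  \<comment> \<open>For \<open>k\<close> outside \<open>S\<close>, vanishing of \<open>t\<close> on
    \<open>L k\<close> settles \<open>u k\<close>. For \<open>k\<close> in \<open>S\<close>,
    \<open>u\<close> must first vanish on \<open>M k\<close>, which calls for \<open>L m\<close>
    with \<open>m\<close> in \<open>M k\<close>; \<open>L k\<close> then supplies
    \<open>t k = 0\<close>.\<close>
  define W where "W = (\<Union>k<N. L k \<union> (\<Union>m\<in>M k. L m))"
  have "finite W" using gluingD(1)[OF gl] by (simp add: W_def L_def)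
  moreover have "u k = 0" if g: "(i t, j u) \<in> graph h" and tW: "t \<in> Tl_vanish l W"
    and u: "u \<in> carrier (Tl_group l)" and k: "k < N" for t u k
  proof -
    have t: "t \<in> carrier (Tl_group l)" using tW by (simp add: Tl_vanish_def)
    have sub: "t \<in> Tl_vanish l V" if "V \<subseteq> W" for V
      using that tW by (auto simp: Tl_vanish_def)
    note coords = graph_coordinates[OF gl g t u, folded L_def]
    show ?thesis
    proof (cases "k \<in> S")
      case True
      have "u m = 0" if m: "m \<in> M k" for m
      proof (rule coords(1))
        show "m \<notin> S" using gluingD(4)[OF gl True] m by blast
        show "t \<in> Tl_vanish l (L m)" using k m by (intro sub) (auto simp: W_def)
      qed
      then have "u \<in> Tl_vanish l (M k)" using u by (simp add: Tl_vanish_def)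
      moreover have "t \<in> Tl_vanish l {k}" using k by (intro sub) (auto simp: W_def L_def)
      then have "t k = 0" by (simp add: Tl_vanish_def)
      ultimately show ?thesis by (intro coords(2)[OF True])
    next
      case False
      show ?thesis by (rule coords(1)[OF False]) (use k in \<open>auto intro!: sub simp: W_def\<close>)
    qed
  qed
  ultimately show thesis using that by blast
qed

text \<open>The sign compensates for \<open>u k - t k\<close> turning into \<open>t k - u k\<close>;
  \<open>M\<close> is kept, since the two kinds of coordinates trade places.\<close>

lemma gluing_swap:
  assumes gl: "gluing S M h"
  defines "h' \<equiv> \<lambda>k w. - h k (snd w, fst w)"
  shows "two_tl_extensions.gluing l G j s D i p (- S) M h'"
    and "(x, y) \<in> graph h \<longleftrightarrow> (y, x) \<in> two_tl_extensions.graph l G s D p h'"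
proof -
  interpret swap: two_tl_extensions A l G TG j s D TD i p by (rule swapped)
  have c: "(y, x) \<in> carrier swap.fibre \<longleftrightarrow> (x, y) \<in> carrier fibre" for x y by auto
  show "swap.gluing (- S) M h'"
    unfolding swap.gluing_def
  proof (intro allI conjI ballI impI)
    fix k
    show "finite (M k)" by (rule gluingD(1)[OF gl])
    show "M k \<subseteq> - S" if "k \<notin> - S" using gluingD(4)[OF gl] that by simp
    show "M k \<subseteq> - (- S)" if "k \<in> - S" using gluingD(3)[OF gl] that by simp
    {
      fix v w assume vw: "v \<in> carrier swap.fibre" "w \<in> carrier swap.fibre"
      obtain y x y' x' where eq: "v = (y, x)" "w = (y', x')" by (cases v, cases w)
      have "int l ^ k dvd h k ((x, y) \<otimes>\<^bsub>fibre\<^esub> (x', y')) - h k (x, y) - h k (x', y')"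
        using vw by (intro gluingD(2)[OF gl]) (simp_all add: eq)
      moreover have "h' k (v \<otimes>\<^bsub>swap.fibre\<^esub> w) - h' k v - h' k w =
          - (h k ((x, y) \<otimes>\<^bsub>fibre\<^esub> (x', y')) - h k (x, y) - h k (x', y'))"
        by (simp add: h'_def eq)
      ultimately show "int l ^ k dvd h' k (v \<otimes>\<^bsub>swap.fibre\<^esub> w) - h' k v - h' k w"
        by (simp only: dvd_minus_iff)
    }
    show "int l ^ k dvd h' k (j u, i t) - (t k - u k)"
      if "k \<notin> - S" "u \<in> Tl_vanish l (M k)" "t \<in> carrier (Tl_group l)" for t u
    proof -
      have "int l ^ k dvd - (h k (i t, j u) - (u k - t k))"
        using gluingD(6)[OF gl _ that(3,2)] that(1) by (simp only: dvd_minus_iff) simp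
      then show ?thesis by (simp add: h'_def algebra_simps)
    qed
    show "int l ^ k dvd h' k (j u, i t) - (t k - u k)"
      if "k \<in> - S" "u \<in> carrier (Tl_group l)" "t \<in> Tl_vanish l (M k)" for t u
    proof -
      have "int l ^ k dvd - (h k (i t, j u) - (u k - t k))"
        using gluingD(5)[OF gl _ that(3,2)] that(1) by (simp only: dvd_minus_iff) simp
      then show ?thesis by (simp add: h'_def algebra_simps)
    qed
  qed
  show "(x, y) \<in> graph h \<longleftrightarrow> (y, x) \<in> swap.graph h'"
    unfolding graph_def swap.graph_def by (auto simp: h'_def)
qed

text \<open>The graph defines a bijective homomorphism that is continuous at the identity, hence
  everywhere; a continuous bijection from a compact to a Hausdorff space is a homeomorphism.\<close>

lemma gluing_imp_iso:
  assumes gl: "gluing S M h"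
  shows "top_group_iso D TD G TG"
proof -
  interpret swap: two_tl_extensions A l G TG j s D TD i p by (rule swapped)
  define f where "f x = (THE y. (x, y) \<in> graph h)" for x
  have graph_f: "(x, y) \<in> graph h \<longleftrightarrow> y = f x" if x: "x \<in> carrier D" for x y
  proof -
    have "\<exists>!y. (x, y) \<in> graph h" using graph_exists[OF gl x] graph_unique[OF gl] by blast
    then show ?thesis unfolding f_def by (metis theI')
  qed
  have f: "(x, f x) \<in> graph h" if "x \<in> carrier D" for x using graph_f that by simp
  have f_closed: "f x \<in> carrier G" "p x = s (f x)" if "x \<in> carrier D" for x
    using f[OF that] by (simp_all add: graph_def)
  have hom: "f \<in> hom D G"
  proof (rule homI)
    fix x y assume xy: "x \<in> carrier D" "y \<in> carrier D"
    have "(x, f x) \<otimes>\<^bsub>fibre\<^esub> (y, f y) \<in> graph h" by (intro graph_closed[OF gl] f xy)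
    then show "f (x \<otimes>\<^bsub>D\<^esub> y) = f x \<otimes>\<^bsub>G\<^esub> f y" using xy graph_f by simp
  qed (rule f_closed)
  have bij: "bij_betw f (carrier D) (carrier G)"
  proof (rule bij_betw_imageI)
    show "inj_on f (carrier D)"
    proof (rule inj_onI)
      fix x y assume xy: "x \<in> carrier D" "y \<in> carrier D" "f x = f y"
      have "(x, f y) \<in> graph h" "(y, f y) \<in> graph h" using f[OF xy(1)] f[OF xy(2)] xy(3) by auto
      then show "x = y" using swap.graph_unique[OF gluing_swap(1)[OF gl]] gluing_swap(2)[OF gl] by blast
    qed
    show "f ` carrier D = carrier G"
    proof
      show "carrier G \<subseteq> f ` carrier D"
      proof
        fix y assume "y \<in> carrier G"
        then obtain x where "(x, y) \<in> graph h"
          using swap.graph_exists[OF gluing_swap(1)[OF gl]] gluing_swap(2)[OF gl] by blast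
        moreover from this have "x \<in> carrier D" by (simp add: graph_def)
        ultimately show "y \<in> f ` carrier D" using graph_f by blast
      qed
    qed (use f_closed in auto)
  qed
  have cont: "continuous_map TD TG f"
  proof (rule continuous_map_hom_at_one[OF E.top F.top hom])
    fix V assume V: "openin TG V" "\<one>\<^bsub>G\<^esub> \<in> V"
    let ?U = "{u \<in> topspace (Tl_top l). j u \<in> V}"
    have zero: "(\<lambda>k. 0) \<in> Tl_vanish l K" for K
      using E.l_gt_1 by (simp add: Tl_vanish_def Tl_carrier)
    have i0: "i (\<lambda>k. 0) = \<one>\<^bsub>D\<^esub>" "j (\<lambda>k. 0) = \<one>\<^bsub>G\<^esub>"
      using E.i.hom_one F.i.hom_one by (simp_all add: Tl_one)
    have "openin (Tl_top l) ?U"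
      by (rule openin_continuous_map_preimage[OF F.i_cont V(1)])
    moreover have "(\<lambda>k. 0) \<in> ?U"
      using V zero[of "{}"] by (simp add: i0 topspace_Tl_top Tl_vanish_def)
    ultimately obtain N where N: "\<And>u. u \<in> carrier (Tl_group l) \<Longrightarrow> (\<And>k. k < N \<Longrightarrow> u k = 0) \<Longrightarrow> u \<in> ?U"
      using Tl_neighbourhood[of l ?U "\<lambda>k. 0"] by blast
    obtain W where W: "finite W" and
      Wz: "\<And>t u k. (i t, j u) \<in> graph h \<Longrightarrow> t \<in> Tl_vanish l W \<Longrightarrow> u \<in> carrier (Tl_group l) \<Longrightarrow>
         k < N \<Longrightarrow> u k = 0"
      using graph_functional_at_one[OF gl, of N] by blast
    show "\<exists>W. openin TD W \<and> \<one>\<^bsub>D\<^esub> \<in> W \<and> f ` W \<subseteq> V"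
    proof (intro exI conjI)
      show "openin TD (i ` Tl_vanish l W)"
        by (rule E.openin_i_image[OF openin_Tl_vanish[OF W]])
      show "\<one>\<^bsub>D\<^esub> \<in> i ` Tl_vanish l W" using zero i0 by (metis imageI)
      show "f ` i ` Tl_vanish l W \<subseteq> V"
      proof (intro subsetI)
        fix y assume "y \<in> f ` i ` Tl_vanish l W"
        then obtain t where t: "t \<in> Tl_vanish l W" "y = f (i t)" by blast
        have tT: "t \<in> carrier (Tl_group l)" using t by (simp add: Tl_vanish_def)
        have it: "i t \<in> carrier D" using tT by simp
        \<comment> \<open>\<open>f\<close> is a map over \<open>A\<close>, so it carries the image
          of \<open>i\<close> into the image of \<open>j\<close>, where coordinates are
          available.\<close>
        have "s (f (i t)) = \<one>\<^bsub>A\<^esub>" using f_closed(2)[OF it] tT by simp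
        then obtain u where u: "u \<in> carrier (Tl_group l)" "f (i t) = j u"
          using F.p_one_cases[OF f_closed(1)[OF it]] by blast
        have "u \<in> ?U" using Wz[OF _ t(1) u(1)] f[OF it] u by (intro N) simp_all
        then show "y \<in> V" using t u by simp
      qed
    qed
  qed
  have "homeomorphic_map TD TG f"
    using bij
    by (intro continuous_imp_homeomorphic_map[OF cont E.compact F.Hausdorff])
      (simp_all add: E.topspace_TG F.topspace_TG bij_betw_def)
  moreover have "f \<in> iso D G" using hom bij by (simp add: iso_def)
  ultimately show ?thesis unfolding top_group_iso_def by blast
qed

text \<open>Consecutive intervals are chosen alternately: the one with index \<open>2 * k\<close>
  detects \<open>l ^ k\<close> in \<open>D\<close>, the one with index \<open>2 * k + 1\<close>
  detects it in \<open>G\<close>. With \<open>S\<close> the union of the even ones, each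
  \<open>k\<close> has a detecting interval on either side.\<close>

lemma gluing_exists: "\<exists>S M h. gluing S M h"
proof -
  interpret swap: two_tl_extensions A l G TG j s D TD i p by (rule swapped)
  have l: "0 < l ^ k" for k using E.l_gt_1 by simp
  define Q where "Q n N N' \<longleftrightarrow> N < N' \<and>
    (if even n then E.detects (l ^ (n div 2)) {N..<N'} else F.detects (l ^ (n div 2)) {N..<N'})"
    for n N N' :: nat
  have "\<exists>N'. Q n N N'" for n N
  proof (cases "even n")
    case True
    then show ?thesis using E.detects_interval[OF l, of N "n div 2"] unfolding Q_def by metis
  next
    case False
    then show ?thesis using F.detects_interval[OF l, of N "n div 2"] unfolding Q_def by metis
  qed
  then have "\<exists>b. \<forall>n. True \<and> Q n (b n) (b (Suc n))"
    by (intro dependent_nat_choice) auto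
  then obtain b where b: "\<And>n. Q n (b n) (b (Suc n))" by blast
  have mono: "strict_mono b" using b by (simp add: strict_mono_Suc_iff Q_def)
  define I where "I n = {b n..<b (Suc n)}" for n
  have disj: "n = m" if "x \<in> I n" "x \<in> I m" for n m x
  proof (rule ccontr)
    assume "n \<noteq> m"
    then have "Suc n \<le> m \<or> Suc m \<le> n" by linarith
    then have "b (Suc n) \<le> b m \<or> b (Suc m) \<le> b n"
      using strict_mono_less_eq[OF mono] by blast
    then show False using that by (auto simp: I_def)
  qed
  define S where "S = (\<Union>k. I (2 * k))"
  \<comment> \<open>For \<open>k\<close> in \<open>S\<close> the vanishing is imposed on
    \<open>u\<close>, so \<open>M k\<close> must detect in \<open>G\<close> and avoid
    \<open>S\<close>: the odd interval. For other \<open>k\<close> it is the even one.\<close>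
  define M where "M k = (if k \<in> S then I (2 * k + 1) else I (2 * k))" for k
  have MS: "M k \<subseteq> S" if "k \<notin> S" for k using that by (auto simp: M_def S_def)
  have MS': "M k \<subseteq> - S" if "k \<in> S" for k
  proof
    fix x assume "x \<in> M k"
    then have x: "x \<in> I (2 * k + 1)" using that by (simp add: M_def)
    have "x \<notin> I (2 * m)" for m
    proof
      assume "x \<in> I (2 * m)"
      then have "2 * k + 1 = 2 * m" by (rule disj[OF x])
      then show False by presburger
    qed
    then show "x \<in> - S" by (simp add: S_def)
  qed
  have E_det: "E.detects (l ^ k) (M k)" if "k \<notin> S" for k
    using b[of "2 * k"] that by (simp add: Q_def M_def I_def)
  have F_det: "F.detects (l ^ k) (M k)" if "k \<in> S" for k
    using b[of "2 * k + 1"] that by (simp add: Q_def M_def I_def)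
  define P where "P k h \<longleftrightarrow>
     (\<forall>v\<in>carrier fibre. \<forall>w\<in>carrier fibre. int l ^ k dvd h (v \<otimes>\<^bsub>fibre\<^esub> w) - h v - h w) \<and>
     (k \<notin> S \<longrightarrow> (\<forall>t\<in>Tl_vanish l (M k). \<forall>u\<in>carrier (Tl_group l).
        int l ^ k dvd h (i t, j u) - (u k - t k))) \<and>
     (k \<in> S \<longrightarrow> (\<forall>t\<in>carrier (Tl_group l). \<forall>u\<in>Tl_vanish l (M k).
        int l ^ k dvd h (i t, j u) - (u k - t k)))" for k and h :: "'b \<times> 'c \<Rightarrow> int"
  have "\<exists>h. P k h" for k
  proof (cases "k \<in> S")
    case True
    obtain h where h1: "\<And>v w. v \<in> carrier swap.fibre \<Longrightarrow> w \<in> carrier swap.fibre \<Longrightarrow>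
        int l ^ k dvd h (v \<otimes>\<^bsub>swap.fibre\<^esub> w) - h v - h w"
      and h2: "\<And>u t. u \<in> Tl_vanish l (M k) \<Longrightarrow> t \<in> carrier (Tl_group l) \<Longrightarrow>
           int l ^ k dvd h (j u, i t) - (t k - u k)"
      using swap.coordinate_extension[OF F_det[OF True]] by blast
    \<comment> \<open>The character built for the reversed pair extends \<open>t k - u k\<close>,
      hence the sign.\<close>
    define h' where "h' w = - h (snd w, fst w)" for w
    have "int l ^ k dvd h' (v \<otimes>\<^bsub>fibre\<^esub> w) - h' v - h' w"
      if vw: "v \<in> carrier fibre" "w \<in> carrier fibre" for v w
    proof -
      obtain x y x' y' where eq: "v = (x, y)" "w = (x', y')" by (cases v, cases w)
      have "int l ^ k dvd h ((y, x) \<otimes>\<^bsub>swap.fibre\<^esub> (y', x')) - h (y, x) - h (y', x')"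
        using vw by (intro h1) (simp_all add: eq)
      moreover have "h' (v \<otimes>\<^bsub>fibre\<^esub> w) - h' v - h' w =
          - (h ((y, x) \<otimes>\<^bsub>swap.fibre\<^esub> (y', x')) - h (y, x) - h (y', x'))"
        by (simp add: h'_def eq)
      ultimately show ?thesis by (simp only: dvd_minus_iff)
    qed
    moreover have "int l ^ k dvd h' (i t, j u) - (u k - t k)"
      if "t \<in> carrier (Tl_group l)" "u \<in> Tl_vanish l (M k)" for t u
    proof -
      have "int l ^ k dvd - (h (j u, i t) - (t k - u k))"
        using h2[OF that(2,1)] by (simp only: dvd_minus_iff)
      then show ?thesis by (simp add: h'_def algebra_simps)
    qed
    ultimately have "P k h'" using True by (simp add: P_def)
    then show ?thesis by blast
  next
    case False
    obtain h where "\<And>v w. v \<in> carrier fibre \<Longrightarrow> w \<in> carrier fibre \<Longrightarrow>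
        int l ^ k dvd h (v \<otimes>\<^bsub>fibre\<^esub> w) - h v - h w"
      and "\<And>t u. t \<in> Tl_vanish l (M k) \<Longrightarrow> u \<in> carrier (Tl_group l) \<Longrightarrow>
           int l ^ k dvd h (i t, j u) - (u k - t k)"
      using coordinate_extension[OF E_det[OF False]] by blast
    then have "P k h" using False by (simp add: P_def)
    then show ?thesis by blast
  qed
  then obtain h where h: "\<And>k. P k (h k)" by metis
  have "gluing S M h"
    unfolding gluing_def
  proof (intro allI)
    fix k
    have "finite (M k)" by (simp add: M_def I_def)
    then show "finite (M k) \<and>
     (\<forall>v\<in>carrier fibre. \<forall>w\<in>carrier fibre. int l ^ k dvd h k (v \<otimes>\<^bsub>fibre\<^esub> w) - h k v - h k w) \<and>
     (k \<notin> S \<longrightarrow> M k \<subseteq> S \<and> (\<forall>t\<in>Tl_vanish l (M k). \<forall>u\<in>carrier (Tl_group l).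
        int l ^ k dvd h k (i t, j u) - (u k - t k))) \<and>
     (k \<in> S \<longrightarrow> M k \<subseteq> - S \<and> (\<forall>t\<in>carrier (Tl_group l). \<forall>u\<in>Tl_vanish l (M k).
        int l ^ k dvd h k (i t, j u) - (u k - t k)))"
      using h[of k] MS[of k] MS'[of k] unfolding P_def by satx
  qed
  then show ?thesis by blast
qed

lemma top_group_iso: "top_group_iso D TD G TG"
  using gluing_exists gluing_imp_iso by blast

end

lemma good_extension_imp_tl_extension:
  assumes "1 < l" "group A" "good_extension l A D TG"
  obtains i p where "tl_extension A D l TG i p"
proof -
  have pro: "pro_l_abelian l D TG" using assms(3) by (simp add: good_extension_def)
  obtain i p where ip: "i \<in> hom (Tl_group l) D" "continuous_map (Tl_top l) TG i"
    "inj_on i (carrier (Tl_group l))" "p \<in> hom D A"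
    "continuous_map TG (discrete_topology (carrier A)) p" "p ` carrier D = carrier A"
    "i ` carrier (Tl_group l) = kernel D A p"
    "TG closure_of torsion D = i ` carrier (Tl_group l)"
    using assms(3) unfolding good_extension_def by blast
  have "topspace TG = carrier D"
    using pro by (simp add: pro_l_abelian_def topological_group_def)
  then have "torsion D \<subseteq> TG closure_of torsion D"
    by (intro closure_of_subset) (auto simp: torsion_def)
  then have "tl_extension A D l TG i p"
    using pro ip assms(1,2)
    by (simp add: tl_extension_def tl_extension_axioms_def pro_l_abelian_def comm_group_def)
  then show thesis by (rule that)
qed

section \<open>Existence\<close>

text \<open>Compare \<open>l\<close>-adic valuations: \<open>z\<close> contributes fewer than
  \<open>e\<close> of the \<open>e + k\<close> factors, so at least \<open>k\<close> come from
  \<open>n\<close>.\<close>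

lemma prime_power_dvd_mult_cancel:
  fixes l n e k :: nat and z :: int
  assumes l: "Factorial_Ring.prime l" and dvd: "int l ^ (e + k) dvd int n * z" and z: "\<not> int l ^ e dvd z"
    and n: "0 < n"
  shows "l ^ k dvd n"
proof -
  have pl: "Factorial_Ring.prime (int l)" using l by simp
  then have ne: "\<not> is_unit (int l)" using not_prime_unit by blast
  have z0: "z \<noteq> 0" using z by auto
  have "e + k \<le> multiplicity (int l) (int n * z)"
    using dvd ne z0 n by (subst power_dvd_iff_le_multiplicity[symmetric]) auto
  also have "\<dots> = multiplicity (int l) (int n) + multiplicity (int l) z"
    using pl z0 n by (intro prime_elem_multiplicity_mult_distrib) auto
  finally have "k \<le> multiplicity (int l) (int n)"
    using z z0 ne power_dvd_iff_le_multiplicity[of z "int l" e] by auto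
  then have "int l ^ k dvd int n"
    using n ne by (subst power_dvd_iff_le_multiplicity) auto
  then show ?thesis by (metis int_dvd_int_iff of_nat_power)
qed

text \<open>Another prime divisor \<open>r\<close> of the order would, by Sylow, give a subgroup of
  order \<open>r\<close>. A nontrivial element of it would have order dividing the coprime numbers
  \<open>r\<close> and \<open>l ^ n\<close>.\<close>

lemma (in group) order_prime_power:
  assumes l: "Factorial_Ring.prime l" and fin: "finite (carrier G)"
    and tors: "\<And>x. x \<in> carrier G \<Longrightarrow> x [^] (l ^ n :: nat) = \<one>"
  shows "\<exists>m. order G = l ^ m"
proof -
  have pos: "order G > 0" using fin by (simp add: order_gt_0_iff_finite)
  obtain m where m: "order G = l ^ multiplicity l (order G) * m" "\<not> l dvd m"
    using multiplicity_decompose'[of "order G" l] pos l by (metis not_prime_unit less_irrefl)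
  have "m = 1"
  proof (rule ccontr)
    assume "m \<noteq> 1"
    then obtain r where r: "Factorial_Ring.prime r" "r dvd m"
      using prime_factor_nat by blast
    then have "r \<noteq> l" using m by auto
    have "r ^ 1 dvd order G" using r m(1) by (metis dvd_mult power_one_right)
    then obtain c where "order G = r ^ 1 * c" by blast
    then obtain H where H: "subgroup H G" "card H = r ^ 1"
      using sylow_thm[OF r(1) group_axioms _ fin] by blast
    interpret H: group "G\<lparr>carrier := H\<rparr>"
      by (rule subgroup.subgroup_is_group[OF H(1) group_axioms])
    have "1 < card H" using H r prime_gt_1_nat by simp
    then have "H \<noteq> {\<one>}" by auto
    then obtain x where x: "x \<in> H" "x \<noteq> \<one>"
      using subgroup.one_closed[OF H(1)] by blast
    have xG: "x \<in> carrier G" using H x by (meson subgroup.mem_carrier)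
    have "x [^]\<^bsub>G\<lparr>carrier := H\<rparr>\<^esub> order (G\<lparr>carrier := H\<rparr>) = \<one>\<^bsub>G\<lparr>carrier := H\<rparr>\<^esub>"
      using x by (intro H.pow_order_eq_1) simp
    then have "x [^] r = \<one>"
      using H by (simp add: order_def nat_pow_consistent[symmetric])
    then have "ord x dvd r" using pow_eq_id[OF xG] by simp
    moreover have "ord x dvd l ^ n" using pow_eq_id[OF xG] tors[OF xG] by simp
    moreover have "coprime r (l ^ n)"
      using r(1) l \<open>r \<noteq> l\<close> by (simp add: primes_coprime)
    ultimately have "ord x = 1" by (metis coprime_common_divisor_nat)
    then show False using x pow_ord_eq_1[OF xG] xG by simp
  qed
  then show ?thesis using m by auto
qed

text \<open>The product of two discrete spaces is discrete, so any operation \<open>F\<close> on it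
  is continuous.\<close>

lemma continuous_map_discrete_binop:
  assumes "continuous_map TX (discrete_topology U) f" "continuous_map TX (discrete_topology V) g"
    and "\<And>x y. x \<in> U \<Longrightarrow> y \<in> V \<Longrightarrow> F x y \<in> W"
  shows "continuous_map TX (discrete_topology W) (\<lambda>x. F (f x) (g x))"
proof -
  have "continuous_map TX (discrete_topology (U \<times> V)) (\<lambda>x. (f x, g x))"
    using assms by (simp add: prod_topology_discrete_topology continuous_map_pairedI)
  moreover have "continuous_map (discrete_topology (U \<times> V)) (discrete_topology W) (\<lambda>(x, y). F x y)"
    using assms(3) by auto
  ultimately have "continuous_map TX (discrete_topology W) ((\<lambda>(x, y). F x y) \<circ> (\<lambda>x. (f x, g x)))"
    by (rule continuous_map_compose)
  then show ?thesis by (simp add: comp_def)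
qed

section \<open>Construction of an extension from characters of \<open>A\<close>\<close>

locale ulm_extension = A: comm_group A
  for A :: "'a monoid" +
  fixes l e :: nat and \<psi> :: "nat \<Rightarrow> 'a \<Rightarrow> int"
  assumes prime: "Factorial_Ring.prime l"
    and finite: "finite (carrier A)"
    and order: "order A = l ^ e"
    and additive: "\<And>k x y. x \<in> carrier A \<Longrightarrow> y \<in> carrier A \<Longrightarrow>
          int l ^ e dvd \<psi> k (x \<otimes>\<^bsub>A\<^esub> y) - \<psi> k x - \<psi> k y"
    and separating: "\<And>x K. x \<in> carrier A \<Longrightarrow> x \<noteq> \<one>\<^bsub>A\<^esub> \<Longrightarrow> \<exists>k\<ge>K. \<not> int l ^ e dvd \<psi> k x"
begin

abbreviation q :: int where "q \<equiv> int l ^ e"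

text \<open>The \<open>k\<close>-th coordinate is the extension of \<open>A\<close> by \<open>q\<int>/ql\<^sup>k \<cong> \<int>/l\<^sup>k\<close>
  obtained by pulling back \<open>\<int>/ql\<^sup>k \<rightarrow> \<int>/q\<close> along the character \<open>\<psi> k\<close>.\<close>

definition D :: "((nat \<Rightarrow> int) \<times> 'a) monoid" where
  "D = \<lparr> carrier = {(z, a). a \<in> carrier A \<and> (\<forall>k. 0 \<le> z k \<and> z k < q * int l ^ k \<and> q dvd z k - \<psi> k a)},
         mult = (\<lambda>(z, a) (w, b). (\<lambda>k. (z k + w k) mod (q * int l ^ k), a \<otimes>\<^bsub>A\<^esub> b)),
         one = (\<lambda>k. 0, \<one>\<^bsub>A\<^esub>) \<rparr>"

text \<open>Here \<open>z\<close> and \<open>a\<close> are not yet linked: this is a compact product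
  in which \<open>carrier D\<close> is closed, so \<open>D\<close> inherits compactness.\<close>

definition ambient :: "((nat \<Rightarrow> int) \<times> 'a) topology" where
  "ambient = prod_topology
     (product_topology (\<lambda>k. discrete_topology {0..<q * int l ^ k}) UNIV) (discrete_topology (carrier A))"

definition TD :: "((nat \<Rightarrow> int) \<times> 'a) topology" where
  "TD = subtopology ambient (carrier D)"

lemma l_pos: "0 < l" using prime prime_gt_0_nat by blast

lemma q_pos: "0 < q * int l ^ k" using l_pos by simp

lemma D_carrier: "(z, a) \<in> carrier D \<longleftrightarrow>
    a \<in> carrier A \<and> (\<forall>k. 0 \<le> z k \<and> z k < q * int l ^ k \<and> q dvd z k - \<psi> k a)"
  by (simp add: D_def)

lemma D_mult: "(z, a) \<otimes>\<^bsub>D\<^esub> (w, b) = (\<lambda>k. (z k + w k) mod (q * int l ^ k), a \<otimes>\<^bsub>A\<^esub> b)"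
  by (simp add: D_def)

lemma D_one: "\<one>\<^bsub>D\<^esub> = (\<lambda>k. 0, \<one>\<^bsub>A\<^esub>)"
  by (simp add: D_def)

text \<open>Reduction modulo a multiple of \<open>q\<close> preserves residues modulo
  \<open>q\<close>, so the lifting condition survives the reductions in the group law.\<close>

lemma dvd_mod_q: "q dvd x mod (q * int l ^ k) - y \<longleftrightarrow> q dvd x - y"
proof -
  have "q dvd x mod (q * int l ^ k) - x"
    using dvd_mod_diff[of "q * int l ^ k" x] by (rule dvd_mult_left)
  from dvd_add_right_iff[OF this, of "x - y"] show ?thesis by simp
qed

lemma char_one: "q dvd \<psi> k \<one>\<^bsub>A\<^esub>"
  using additive[of "\<one>\<^bsub>A\<^esub>" "\<one>\<^bsub>A\<^esub>" k] by simp

lemma D_mult_closed: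
  assumes "v \<in> carrier D" "w \<in> carrier D"
  shows "v \<otimes>\<^bsub>D\<^esub> w \<in> carrier D"
proof -
  obtain z a y b where eq: "v = (z, a)" "w = (y, b)" by (cases v, cases w)
  have "q dvd z k + y k - \<psi> k (a \<otimes>\<^bsub>A\<^esub> b)" for k
  proof -
    have "q dvd z k - \<psi> k a" "q dvd y k - \<psi> k b"
      "q dvd \<psi> k (a \<otimes>\<^bsub>A\<^esub> b) - \<psi> k a - \<psi> k b"
      using assms by (simp_all add: eq D_carrier additive)
    from dvd_diff[OF dvd_add[OF this(1,2)] this(3)] show ?thesis by (simp add: algebra_simps)
  qed
  then show ?thesis using assms q_pos by (simp add: eq D_carrier D_mult dvd_mod_q)
qed

text \<open>An explicit inverse, available before \<open>D\<close> is known to be a group;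
  continuity of inversion can then be checked coordinatewise.\<close>

definition neg :: "(nat \<Rightarrow> int) \<times> 'a \<Rightarrow> (nat \<Rightarrow> int) \<times> 'a" where
  "neg w = (\<lambda>k. (- fst w k) mod (q * int l ^ k), inv\<^bsub>A\<^esub> (snd w))"

lemma neg:
  assumes "w \<in> carrier D"
  shows "neg w \<in> carrier D" "neg w \<otimes>\<^bsub>D\<^esub> w = \<one>\<^bsub>D\<^esub>"
proof -
  obtain z a where eq: "w = (z, a)" by (cases w)
  have a: "a \<in> carrier A" using assms by (simp add: eq D_carrier)
  have "q dvd - z k - \<psi> k (inv\<^bsub>A\<^esub> a)" for k
  proof -
    have "q dvd \<psi> k \<one>\<^bsub>A\<^esub> - \<psi> k (inv\<^bsub>A\<^esub> a) - \<psi> k a"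
      using additive[OF A.inv_closed[OF a] a, of k] a by simp
    moreover have "q dvd z k - \<psi> k a" using assms by (simp add: eq D_carrier)
    ultimately have "q dvd (\<psi> k \<one>\<^bsub>A\<^esub> - \<psi> k (inv\<^bsub>A\<^esub> a) - \<psi> k a) - \<psi> k \<one>\<^bsub>A\<^esub> - (z k - \<psi> k a)"
      by (intro dvd_diff[OF dvd_diff[OF _ char_one]])
    then show ?thesis by (simp add: minus_diff_commute)
  qed
  then show "neg w \<in> carrier D"
    using a q_pos by (simp add: eq neg_def D_carrier dvd_mod_q)
  show "neg w \<otimes>\<^bsub>D\<^esub> w = \<one>\<^bsub>D\<^esub>"
    using a by (simp add: eq neg_def D_mult D_one mod_simps)
qed

sublocale D: comm_group D
proof (rule comm_groupI)
  show "\<one>\<^bsub>D\<^esub> \<in> carrier D" using q_pos char_one by (simp add: D_one D_carrier)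
next
  fix u v w assume "u \<in> carrier D" "v \<in> carrier D" "w \<in> carrier D"
  then show "u \<otimes>\<^bsub>D\<^esub> v \<otimes>\<^bsub>D\<^esub> w = u \<otimes>\<^bsub>D\<^esub> (v \<otimes>\<^bsub>D\<^esub> w)"
    by (cases u, cases v, cases w) (simp add: D_carrier D_mult mod_simps add.assoc A.m_assoc)
next
  fix v w assume "v \<in> carrier D" "w \<in> carrier D"
  then show "v \<otimes>\<^bsub>D\<^esub> w = w \<otimes>\<^bsub>D\<^esub> v"
    by (cases v, cases w) (simp add: D_carrier D_mult add.commute A.m_comm)
next
  fix w assume "w \<in> carrier D"
  then show "\<one>\<^bsub>D\<^esub> \<otimes>\<^bsub>D\<^esub> w = w"
    by (cases w) (simp add: D_carrier D_mult D_one)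
qed (use neg D_mult_closed in blast)+

lemma D_inv: "w \<in> carrier D \<Longrightarrow> inv\<^bsub>D\<^esub> w = neg w"
  using neg D.inv_equality by blast

lemma D_pow: "(z, a) [^]\<^bsub>D\<^esub> (n::nat) = (\<lambda>k. (int n * z k) mod (q * int l ^ k), a [^]\<^bsub>A\<^esub> n)"
  by (induction n) (simp_all add: D_one D_mult mod_simps distrib_right add.commute)

lemma topspace_ambient:
  "(z, a) \<in> topspace ambient \<longleftrightarrow> a \<in> carrier A \<and> (\<forall>k. 0 \<le> z k \<and> z k < q * int l ^ k)"
  by (auto simp: ambient_def PiE_UNIV_domain)

lemma carrier_subset_ambient: "carrier D \<subseteq> topspace ambient"
proof
  fix w assume "w \<in> carrier D"
  then show "w \<in> topspace ambient" by (cases w) (simp add: topspace_ambient D_carrier)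
qed

lemma topspace_TD: "topspace TD = carrier D"
  using carrier_subset_ambient by (auto simp: TD_def)

lemma ambient_coordinate:
  "continuous_map ambient (discrete_topology {0..<q * int l ^ k}) (\<lambda>w. fst w k)"
proof -
  have "continuous_map ambient (discrete_topology {0..<q * int l ^ k}) ((\<lambda>z. z k) \<circ> fst)"
    unfolding ambient_def
    by (rule continuous_map_compose[OF continuous_map_fst continuous_map_product_projection]) simp
  then show ?thesis by (simp add: comp_def)
qed

lemma ambient_snd: "continuous_map ambient (discrete_topology (carrier A)) snd"
  unfolding ambient_def by (rule continuous_map_snd)

lemma TD_coordinate:
  "continuous_map TD (discrete_topology {0..<q * int l ^ k}) (\<lambda>w. fst w k)"
  unfolding TD_def by (rule continuous_map_from_subtopology[OF ambient_coordinate])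

lemma TD_snd: "continuous_map TD (discrete_topology (carrier A)) snd"
  unfolding TD_def by (rule continuous_map_from_subtopology[OF ambient_snd])

lemma continuous_map_into_TD:
  assumes "\<And>x. x \<in> topspace TX \<Longrightarrow> f x \<in> carrier D"
    and "\<And>k. continuous_map TX (discrete_topology {0..<q * int l ^ k}) (\<lambda>x. fst (f x) k)"
    and "continuous_map TX (discrete_topology (carrier A)) (\<lambda>x. snd (f x))"
  shows "continuous_map TX TD f"
proof -
  have "continuous_map TX ambient f"
    unfolding ambient_def continuous_map_pairwise
    using assms(2,3) by (simp add: continuous_map_componentwise_UNIV comp_def)
  then show ?thesis
    unfolding TD_def using assms(1) by (intro continuous_map_into_subtopology) auto
qed

text \<open>Each congruence involves one coordinate of \<open>z\<close> and the component
  \<open>a\<close>, so it cuts out the preimage of a subset of a discrete space.\<close>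

lemma closedin_carrier: "closedin ambient (carrier D)"
proof -
  define B where "B k = {w \<in> topspace ambient. (fst w k, snd w) \<in>
      {0..<q * int l ^ k} \<times> carrier A \<inter> {(x, a). q dvd x - \<psi> k a}}" for k
  have "closedin ambient (B k)" for k
    unfolding B_def
  proof (rule closedin_continuous_map_preimage)
    show "continuous_map ambient (discrete_topology ({0..<q * int l ^ k} \<times> carrier A))
        (\<lambda>w. (fst w k, snd w))"
      using ambient_coordinate ambient_snd
      by (simp add: prod_topology_discrete_topology continuous_map_pairedI)
  qed auto
  then have "closedin ambient (\<Inter>k. B k)" by (intro closedin_INT) auto
  also have "(\<Inter>k. B k) = carrier D"
    by (auto simp: B_def topspace_ambient D_carrier)
  finally show ?thesis .
qed

lemma compact_space_TD: "compact_space TD"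
proof -
  have "compact_space ambient"
    using finite
    by (simp add: ambient_def compact_space_prod_topology compact_space_product_topology
        compact_space_discrete_topology)
  then show ?thesis
    unfolding TD_def by (intro compact_space_subtopology closedin_compact_space closedin_carrier)
qed

lemma Hausdorff_space_TD: "Hausdorff_space TD"
  unfolding TD_def ambient_def
  by (intro Hausdorff_space_subtopology)
    (simp add: Hausdorff_space_prod_topology Hausdorff_space_product_topology)

lemma topological_group_D: "topological_group D TD"
  unfolding topological_group_def
proof (intro conjI)
  show "group D" by (rule D.group_axioms)
  show "topspace TD = carrier D" by (rule topspace_TD)
  let ?P = "prod_topology TD TD"
  have coord: "continuous_map ?P (discrete_topology {0..<q * int l ^ k}) (\<lambda>x. fst (fst x) k)"
    "continuous_map ?P (discrete_topology {0..<q * int l ^ k}) (\<lambda>x. fst (snd x) k)" for k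
    using continuous_map_compose[OF continuous_map_fst TD_coordinate]
      continuous_map_compose[OF continuous_map_snd TD_coordinate] by (simp_all add: comp_def)
  have snd: "continuous_map ?P (discrete_topology (carrier A)) (\<lambda>x. snd (fst x))"
    "continuous_map ?P (discrete_topology (carrier A)) (\<lambda>x. snd (snd x))"
    using continuous_map_compose[OF continuous_map_fst TD_snd]
      continuous_map_compose[OF continuous_map_snd TD_snd] by (simp_all add: comp_def)
  show "continuous_map ?P TD (\<lambda>(x, y). x \<otimes>\<^bsub>D\<^esub> y)"
  proof (rule continuous_map_into_TD)
    show "(case x of (x, y) \<Rightarrow> x \<otimes>\<^bsub>D\<^esub> y) \<in> carrier D" if "x \<in> topspace ?P" for x
      using that D_mult_closed by (auto simp: topspace_TD)
    show "continuous_map ?P (discrete_topology {0..<q * int l ^ k})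
        (\<lambda>x. fst (case x of (x, y) \<Rightarrow> x \<otimes>\<^bsub>D\<^esub> y) k)" for k
      using continuous_map_discrete_binop[OF coord(1)[of k] coord(2)[of k],
          of "\<lambda>x y. (x + y) mod (q * int l ^ k)"] q_pos[of k]
      by (simp add: case_prod_beta D_def)
    show "continuous_map ?P (discrete_topology (carrier A)) (\<lambda>x. snd (case x of (x, y) \<Rightarrow> x \<otimes>\<^bsub>D\<^esub> y))"
      using continuous_map_discrete_binop[OF snd, of "\<lambda>x y. x \<otimes>\<^bsub>A\<^esub> y"]
      by (simp add: case_prod_beta D_def)
  qed
  have "continuous_map TD TD neg"
  proof (rule continuous_map_into_TD)
    show "neg w \<in> carrier D" if "w \<in> topspace TD" for w using that neg by (simp add: topspace_TD)
    show "continuous_map TD (discrete_topology {0..<q * int l ^ k}) (\<lambda>x. fst (neg x) k)" for k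
      using continuous_map_discrete_binop[OF TD_coordinate[of k] TD_coordinate[of k],
          of "\<lambda>x y. (- x) mod (q * int l ^ k)"] q_pos[of k]
      by (simp add: neg_def)
    show "continuous_map TD (discrete_topology (carrier A)) (\<lambda>x. snd (neg x))"
      using continuous_map_discrete_binop[OF TD_snd TD_snd, of "\<lambda>x y. inv\<^bsub>A\<^esub> x"]
      by (simp add: neg_def)
  qed
  then show "continuous_map TD TD (m_inv D)"
    by (rule continuous_map_eq) (simp add: topspace_TD D_inv)
qed

section \<open>Open subgroups and the pro-\<open>l\<close> property\<close>

definition level :: "nat \<Rightarrow> ((nat \<Rightarrow> int) \<times> 'a) set" where
  "level N = {w \<in> carrier D. snd w = \<one>\<^bsub>A\<^esub> \<and> (\<forall>k<N. fst w k = 0)}"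

lemma subgroup_level: "subgroup (level N) D"
proof (rule D.subgroupI)
  have "\<one>\<^bsub>D\<^esub> \<in> level N" using D.one_closed by (simp add: level_def D_one)
  then show "level N \<noteq> {}" by blast
  show "level N \<subseteq> carrier D" by (auto simp: level_def)
  show "inv\<^bsub>D\<^esub> w \<in> level N" if "w \<in> level N" for w
    using that neg(1)[of w] by (simp add: level_def D_inv) (simp add: neg_def)
  show "v \<otimes>\<^bsub>D\<^esub> w \<in> level N" if "v \<in> level N" "w \<in> level N" for v w
    using that D_mult_closed[of v w] by (cases v, cases w) (simp add: level_def D_mult)
qed

lemma openin_level: "openin TD (level N)"
proof -
  have "openin TD ({w \<in> topspace TD. snd w \<in> {\<one>\<^bsub>A\<^esub>}} \<inter>
      (\<Inter>k\<in>{..<N}. {w \<in> topspace TD. fst w k \<in> {0}}) )" if "N > 0"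
    using that q_pos
    by (intro openin_Int openin_INT2 openin_continuous_map_preimage[OF TD_snd]
        openin_continuous_map_preimage[OF TD_coordinate]) auto
  moreover have "openin TD {w \<in> topspace TD. snd w \<in> {\<one>\<^bsub>A\<^esub>}}"
    by (intro openin_continuous_map_preimage[OF TD_snd]) auto
  moreover have "level N = {w \<in> topspace TD. snd w \<in> {\<one>\<^bsub>A\<^esub>}} \<inter>
      (\<Inter>k\<in>{..<N}. {w \<in> topspace TD. fst w k \<in> {0}})" if "N > 0"
    using that by (auto simp: level_def topspace_TD)
  moreover have "level 0 = {w \<in> topspace TD. snd w \<in> {\<one>\<^bsub>A\<^esub>}}"
    by (auto simp: level_def topspace_TD)
  ultimately show ?thesis by (cases "N = 0") simp_all
qed

text \<open>A basic box restricts finitely many coordinates, so the subgroups \<open>level N\<close>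
  form a neighbourhood basis of the identity.\<close>

lemma level_subset:
  assumes U: "openin TD U" and one: "\<one>\<^bsub>D\<^esub> \<in> U"
  obtains N where "level N \<subseteq> U"
proof -
  obtain U' where U': "openin ambient U'" "U = U' \<inter> carrier D"
    using U unfolding TD_def openin_subtopology by blast
  have "(\<lambda>k. 0, \<one>\<^bsub>A\<^esub>) \<in> U'" using one U' by (simp add: D_one)
  then obtain V W where VW: "openin (product_topology (\<lambda>k. discrete_topology {0..<q * int l ^ k}) UNIV) V"
    "(\<lambda>k. 0) \<in> V" "\<one>\<^bsub>A\<^esub> \<in> W" "V \<times> W \<subseteq> U'"
    using U'(1) unfolding ambient_def openin_prod_topology_alt by blast
  obtain N where N: "\<And>z. (\<And>k. z k \<in> {0..<q * int l ^ k}) \<Longrightarrow> (\<And>k. k < N \<Longrightarrow> z k = 0) \<Longrightarrow> z \<in> V"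
    using product_discrete_neighbourhood[OF VW(1,2)] by blast
  have "level N \<subseteq> U"
  proof
    fix w assume w: "w \<in> level N"
    obtain z a where eq: "w = (z, a)" by (cases w)
    have "z \<in> V" using w by (intro N) (simp_all add: eq level_def D_carrier)
    then have "w \<in> U'" using VW w by (auto simp: eq level_def)
    then show "w \<in> U" using U' w by (simp add: level_def)
  qed
  then show thesis by (rule that)
qed

text \<open>\<open>l ^ e\<close> annihilates \<open>A\<close>, and the moduli of the first
  \<open>N\<close> coordinates divide \<open>l ^ (e + N)\<close>. This bounds the exponent of
  quotients by open subgroups.\<close>

lemma pow_in_level:
  assumes "w \<in> carrier D"
  shows "w [^]\<^bsub>D\<^esub> (l ^ (e + N) :: nat) \<in> level N"
proof -
  obtain z a where eq: "w = (z, a)" by (cases w)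
  have a: "a \<in> carrier A" using assms by (simp add: eq D_carrier)
  have "a [^]\<^bsub>A\<^esub> (l ^ (e + N)) = (a [^]\<^bsub>A\<^esub> order A) [^]\<^bsub>A\<^esub> (l ^ N)"
    using a by (simp add: order power_add A.nat_pow_pow)
  then have "a [^]\<^bsub>A\<^esub> (l ^ (e + N)) = \<one>\<^bsub>A\<^esub>" using a by (simp add: A.pow_order_eq_1)
  moreover have "(int l ^ (e + N) * z k) mod (q * int l ^ k) = 0" if "k < N" for k
  proof -
    have "q * int l ^ k dvd int l ^ (e + N)"
      using that by (simp add: power_add[symmetric] le_imp_power_dvd)
    then show ?thesis by simp
  qed
  moreover have "w [^]\<^bsub>D\<^esub> (l ^ (e + N)) \<in> carrier D" using assms by simp
  ultimately show ?thesis by (simp add: eq level_def D_pow)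
qed

text \<open>A coset is determined by the \<open>A\<close>-component and the first \<open>N\<close>
  coordinates of a representative, and these take finitely many values.\<close>

lemma finite_rcosets:
  assumes H: "subgroup H D" and N: "level N \<subseteq> H"
  shows "finite (rcosets\<^bsub>D\<^esub> H)"
proof -
  let ?g = "\<lambda>w. (restrict (fst w) {..<N}, snd w)"
  have same: "H #>\<^bsub>D\<^esub> v = H #>\<^bsub>D\<^esub> w" if v: "v \<in> carrier D" and w: "w \<in> carrier D" and g: "?g v = ?g w" for v w
  proof -
    obtain z a y b where eq: "v = (z, a)" "w = (y, b)" by (cases v, cases w)
    have zy: "z k = y k" if "k < N" for k
      using g that by (auto simp: eq dest: fun_cong[of _ _ k])
    have ab: "a = b" using g by (simp add: eq)
    have "v \<otimes>\<^bsub>D\<^esub> inv\<^bsub>D\<^esub> w \<in> carrier D" using v w by simp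
    then have "v \<otimes>\<^bsub>D\<^esub> inv\<^bsub>D\<^esub> w \<in> level N"
      using v w zy ab by (simp add: eq level_def D_inv) (simp add: neg_def D_mult mod_simps D_carrier)
    then have "v \<otimes>\<^bsub>D\<^esub> inv\<^bsub>D\<^esub> w \<in> H" using N by blast
    then have "v \<in> H #>\<^bsub>D\<^esub> w"
      using v w subgroup.rcos_module_rev[OF H D.group_axioms] by blast
    then show ?thesis using D.repr_independence[OF _ w H] by simp
  qed
  have "finite ((PiE {..<N} (\<lambda>k. {0..<q * int l ^ k})) \<times> carrier A)"
    using finite by (intro finite_cartesian_product finite_PiE) auto
  moreover have "?g ` carrier D \<subseteq> (PiE {..<N} (\<lambda>k. {0..<q * int l ^ k})) \<times> carrier A"
    by (auto simp: D_carrier)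
  ultimately have "finite (?g ` carrier D)" by (rule rev_finite_subset)
  then have "finite ((\<lambda>v. H #>\<^bsub>D\<^esub> (SOME w. w \<in> carrier D \<and> ?g w = v)) ` ?g ` carrier D)"
    by (rule finite_imageI)
  moreover have "rcosets\<^bsub>D\<^esub> H \<subseteq> (\<lambda>v. H #>\<^bsub>D\<^esub> (SOME w. w \<in> carrier D \<and> ?g w = v)) ` ?g ` carrier D"
  proof
    fix C assume "C \<in> rcosets\<^bsub>D\<^esub> H"
    then obtain w where w: "w \<in> carrier D" "C = H #>\<^bsub>D\<^esub> w" by (auto simp: RCOSETS_def)
    let ?s = "SOME v. v \<in> carrier D \<and> ?g v = ?g w"
    have "?s \<in> carrier D \<and> ?g ?s = ?g w" by (rule someI[of _ w]) (simp add: w)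
    then have "C = H #>\<^bsub>D\<^esub> ?s" using same[of ?s w] w by simp
    then show "C \<in> (\<lambda>v. H #>\<^bsub>D\<^esub> (SOME w. w \<in> carrier D \<and> ?g w = v)) ` ?g ` carrier D"
      using w(1) by blast
  qed
  ultimately show ?thesis by (rule rev_finite_subset)
qed

text \<open>Once \<open>level N\<close> lies in \<open>H\<close>, the quotient by \<open>H\<close>
  is finite and killed by \<open>l ^ (e + N)\<close>, so its order is a power of
  \<open>l\<close>.\<close>

lemma index_prime_power:
  assumes H: "subgroup H D" and openH: "openin TD H"
  shows "\<exists>n. card (rcosets\<^bsub>D\<^esub> H) = l ^ n"
proof -
  obtain N where N: "level N \<subseteq> H"
    using level_subset[OF openH subgroup.one_closed[OF H]] .
  interpret H: normal H D using H by (rule D.subgroup_imp_normal)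
  interpret Q: group "D Mod H" by (rule H.factorgroup_is_group)
  interpret proj: group_hom D "D Mod H" "\<lambda>w. H #>\<^bsub>D\<^esub> w"
    by unfold_locales (rule H.r_coset_hom_Mod)
  have "\<exists>m. order (D Mod H) = l ^ m"
  proof (rule Q.order_prime_power[OF prime])
    show "finite (carrier (D Mod H))"
      using finite_rcosets[OF H N] by (simp add: FactGroup_def)
    fix C assume "C \<in> carrier (D Mod H)"
    then obtain w where w: "w \<in> carrier D" "C = H #>\<^bsub>D\<^esub> w" by (auto simp: carrier_FactGroup)
    have "C [^]\<^bsub>D Mod H\<^esub> (l ^ (e + N)) = H #>\<^bsub>D\<^esub> (w [^]\<^bsub>D\<^esub> (l ^ (e + N)))"
      using proj.hom_nat_pow[OF w(1)] w(2) by simp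
    also have "\<dots> = H"
      using pow_in_level[OF w(1), of N] N by (intro D.coset_join2[OF _ H]) (auto simp: w)
    finally show "C [^]\<^bsub>D Mod H\<^esub> (l ^ (e + N)) = \<one>\<^bsub>D Mod H\<^esub>" by simp
  qed
  then show ?thesis by (simp add: order_def FactGroup_def)
qed

lemma pro_l_abelian_D: "pro_l_abelian l D TD"
  unfolding pro_l_abelian_def
proof (intro conjI allI impI)
  fix U assume "openin TD U \<and> \<one>\<^bsub>D\<^esub> \<in> U"
  then obtain N where "level N \<subseteq> U" using level_subset by blast
  then show "\<exists>H. subgroup H D \<and> openin TD H \<and> H \<subseteq> U"
    using subgroup_level openin_level by blast
qed (use topological_group_D D.comm_group_axioms compact_space_TD Hausdorff_space_TD index_prime_power in blast)+

section \<open>The exact sequence and the closure of the torsion subgroup\<close>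

definition embed :: "(nat \<Rightarrow> int) \<Rightarrow> (nat \<Rightarrow> int) \<times> 'a" where
  "embed t = (\<lambda>k. q * t k, \<one>\<^bsub>A\<^esub>)"

lemma embed_closed: "t \<in> carrier (Tl_group l) \<Longrightarrow> embed t \<in> carrier D"
proof -
  assume t: "t \<in> carrier (Tl_group l)"
  have "q dvd q * t k - \<psi> k \<one>\<^bsub>A\<^esub>" for k using char_one by (intro dvd_diff) auto
  then show ?thesis using t l_pos by (simp add: embed_def D_carrier Tl_carrier)
qed

lemma embed_hom: "embed \<in> hom (Tl_group l) D"
proof (rule homI)
  fix t u assume "t \<in> carrier (Tl_group l)" "u \<in> carrier (Tl_group l)"
  then show "embed (t \<otimes>\<^bsub>Tl_group l\<^esub> u) = embed t \<otimes>\<^bsub>D\<^esub> embed u"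
    by (simp add: embed_def D_mult Tl_mult mult_mod_right distrib_left)
qed (rule embed_closed)

lemma embed_continuous: "continuous_map (Tl_top l) TD embed"
proof (rule continuous_map_into_TD)
  show "embed t \<in> carrier D" if "t \<in> topspace (Tl_top l)" for t
    using that embed_closed by (simp add: topspace_Tl_top)
  show "continuous_map (Tl_top l) (discrete_topology {0..<q * int l ^ k}) (\<lambda>t. fst (embed t) k)" for k
    using continuous_map_discrete_binop[OF continuous_map_Tl_coordinate[of l k]
        continuous_map_Tl_coordinate[of l k], of "\<lambda>x y. q * x" "{0..<q * int l ^ k}"] l_pos
    by (simp add: embed_def)
qed (simp add: embed_def)

text \<open>Multiplication by \<open>q\<close> identifies the integers modulo \<open>l ^ k\<close>
  with the multiples of \<open>q\<close> modulo \<open>q * l ^ k\<close>. Over the identity of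
  \<open>A\<close> the lifting condition says that \<open>q\<close> divides \<open>z k\<close>, so
  division by \<open>q\<close> yields the preimage.\<close>

lemma embed_image: "embed ` carrier (Tl_group l) = kernel D A snd"
proof
  show "embed ` carrier (Tl_group l) \<subseteq> kernel D A snd"
    using embed_closed by (auto simp: kernel_def embed_def)
  show "kernel D A snd \<subseteq> embed ` carrier (Tl_group l)"
  proof
    fix w assume "w \<in> kernel D A snd"
    then obtain z where w: "w = (z, \<one>\<^bsub>A\<^esub>)" "w \<in> carrier D" by (cases w) (auto simp: kernel_def)
    have dvd: "q dvd z k" for k
      using w char_one[of k] dvd_add[of q "z k - \<psi> k \<one>\<^bsub>A\<^esub>" "\<psi> k \<one>\<^bsub>A\<^esub>"] by (simp add: D_carrier)
    let ?t = "\<lambda>k. z k div q"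
    have qt: "q * ?t k = z k" for k using dvd by simp
    have "0 \<le> ?t k \<and> ?t k < int l ^ k" for k
    proof -
      have "0 \<le> z k" "q * ?t k < q * int l ^ k" using w qt[of k] by (simp_all add: D_carrier)
      then show ?thesis using l_pos by (simp add: pos_imp_zdiv_nonneg_iff)
    qed
    then have "?t \<in> carrier (Tl_group l)" by (simp add: Tl_carrier)
    moreover have "w = embed ?t" using qt by (simp add: w embed_def)
    ultimately show "w \<in> embed ` carrier (Tl_group l)" by blast
  qed
qed

lemma snd_hom: "snd \<in> hom D A"
proof (rule homI)
  show "snd w \<in> carrier A" if "w \<in> carrier D" for w
    using that by (cases w) (simp add: D_carrier)
  show "snd (v \<otimes>\<^bsub>D\<^esub> w) = snd v \<otimes>\<^bsub>A\<^esub> snd w" for v w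
    by (cases v, cases w) (simp add: D_mult)
qed

lemma snd_image: "snd ` carrier D = carrier A"
proof
  show "snd ` carrier D \<subseteq> carrier A" using snd_hom by (auto simp: hom_def)
  show "carrier A \<subseteq> snd ` carrier D"
  proof
    fix a assume "a \<in> carrier A"
    \<comment> \<open>The character values themselves, reduced modulo \<open>q * l ^ k\<close>, form
      a lift of \<open>a\<close>.\<close>
    then have "(\<lambda>k. \<psi> k a mod (q * int l ^ k), a) \<in> carrier D"
      using q_pos by (simp add: D_carrier dvd_mod_q)
    then show "a \<in> snd ` carrier D" by force
  qed
qed

text \<open>Suppose \<open>n\<close> kills an element over a nontrivial \<open>a\<close>. Choose
  \<open>k \<ge> n\<close> with \<open>\<psi> k a\<close> nonzero modulo \<open>q\<close>, so that
  \<open>q\<close> does not divide \<open>z k\<close>. Since \<open>q * l ^ k\<close> divides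
  \<open>n * z k\<close>, \<open>l ^ k\<close> divides \<open>n\<close>, contrary to
  \<open>n \<le> k < l ^ k\<close>. As \<open>n\<close> is arbitrary, detection must occur at
  arbitrarily large \<open>k\<close>.\<close>

lemma torsion_subset: "torsion D \<subseteq> kernel D A snd"
proof
  fix w assume "w \<in> torsion D"
  then obtain n where w: "w \<in> carrier D" and n: "n > 0" "w [^]\<^bsub>D\<^esub> (n::nat) = \<one>\<^bsub>D\<^esub>"
    by (auto simp: torsion_def)
  obtain z a where eq: "w = (z, a)" by (cases w)
  have "a = \<one>\<^bsub>A\<^esub>"
  proof (rule ccontr)
    assume "a \<noteq> \<one>\<^bsub>A\<^esub>"
    moreover have "a \<in> carrier A" using w by (simp add: eq D_carrier)
    ultimately obtain k where k: "k \<ge> n" "\<not> q dvd \<psi> k a"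
      using separating[of a n] by blast
    have "q dvd z k - \<psi> k a" using w by (simp add: eq D_carrier)
    then have z: "\<not> q dvd z k" using k(2) dvd_diff[of q "z k" "z k - \<psi> k a"] by auto
    have "(int n * z k) mod (q * int l ^ k) = 0"
      using n(2) by (simp add: eq D_pow D_one fun_eq_iff)
    then have "int l ^ (e + k) dvd int n * z k" by (simp add: power_add dvd_eq_mod_eq_0)
    then have "l ^ k dvd n" using z n(1) by (rule prime_power_dvd_mult_cancel[OF prime])
    then have "l ^ k \<le> n" using n(1) by (rule dvd_imp_le)
    moreover have "k < l ^ k" using prime_gt_1_nat[OF prime] by (simp add: power_gt_expt)
    ultimately show False using k(1) by linarith
  qed
  then show "w \<in> kernel D A snd" using w by (simp add: kernel_def eq)
qed

text \<open>The kernel of \<open>snd\<close> is closed and contains the torsion. Conversely, torsion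
  is dense in \<open>T_l\<close>, and the continuous homomorphism \<open>embed\<close> carries this
  density to its image.\<close>

lemma closure_torsion: "TD closure_of torsion D = embed ` carrier (Tl_group l)"
proof
  have "closedin TD {w \<in> topspace TD. snd w \<in> {\<one>\<^bsub>A\<^esub>}}"
    by (intro closedin_continuous_map_preimage[OF TD_snd]) auto
  also have "{w \<in> topspace TD. snd w \<in> {\<one>\<^bsub>A\<^esub>}} = kernel D A snd"
    by (auto simp: kernel_def topspace_TD)
  finally show "TD closure_of torsion D \<subseteq> embed ` carrier (Tl_group l)"
    unfolding embed_image by (intro closure_of_minimal torsion_subset)
  interpret T: comm_group "Tl_group l" by (rule Tl_group_comm_group[OF l_pos])
  interpret i: group_hom "Tl_group l" D embed by unfold_locales (rule embed_hom)
  have "embed ` torsion (Tl_group l) \<subseteq> torsion D"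
    using embed_closed by (auto simp: torsion_def simp flip: i.hom_nat_pow)
  then have "TD closure_of (embed ` torsion (Tl_group l)) \<subseteq> TD closure_of torsion D"
    by (rule closure_of_mono)
  moreover have "embed ` (Tl_top l closure_of torsion (Tl_group l)) \<subseteq>
      TD closure_of (embed ` torsion (Tl_group l))"
    by (rule continuous_map_image_closure_subset[OF embed_continuous])
  ultimately show "embed ` carrier (Tl_group l) \<subseteq> TD closure_of torsion D"
    by (simp add: Tl_torsion_dense[OF l_pos])
qed

lemma good_extension_D: "good_extension l A D TD"
  unfolding good_extension_def
proof (intro conjI exI)
  show "inj_on embed (carrier (Tl_group l))"
    using l_pos by (auto simp: inj_on_def embed_def fun_eq_iff)
qed (fact pro_l_abelian_D embed_hom embed_continuous snd_hom TD_snd snd_image embed_image closure_torsion)+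

end

text \<open>Each nontrivial \<open>a\<close> has a character \<open>h a\<close> detecting it;
  repeating the finite list of these characters periodically makes each occur at arbitrarily large
  indices.\<close>

lemma good_extension_exists:
  fixes A :: "'a monoid"
  assumes l: "Factorial_Ring.prime l" and A: "comm_group A" "finite (carrier A)"
    and card: "card (carrier A) = l ^ e"
  shows "\<exists>(D :: ((nat \<Rightarrow> int) \<times> 'a) monoid) TG. good_extension l A D TG"
proof -
  interpret A: comm_group A by (rule A(1))
  have order: "order A = l ^ e" using card by (simp add: order_def)
  define n where "n = order A"
  have n: "n > 0" using A(2) by (simp add: n_def A.order_gt_0_iff_finite)
  define P where "P a h \<longleftrightarrow>
      (\<forall>x\<in>carrier A. \<forall>y\<in>carrier A. int l ^ e dvd h (x \<otimes>\<^bsub>A\<^esub> y) - h x - h y) \<and>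
      (a \<noteq> \<one>\<^bsub>A\<^esub> \<longrightarrow> \<not> int l ^ e dvd h a)" for a and h :: "'a \<Rightarrow> int"
  have "\<exists>h. P a h" if a: "a \<in> carrier A" for a
  proof (cases "a = \<one>\<^bsub>A\<^esub>")
    case True
    then have "P a (\<lambda>x. 0)" by (simp add: P_def)
    then show ?thesis by blast
  next
    case False
    obtain h where "\<And>x y. x \<in> carrier A \<Longrightarrow> y \<in> carrier A \<Longrightarrow> int (order A) dvd h (x \<otimes>\<^bsub>A\<^esub> y) - h x - h y"
      "\<not> int (order A) dvd h a"
      using A.separating_character[OF A(2) a False] by blast
    then have "P a h" by (simp add: P_def order)
    then show ?thesis by blast
  qed
  then obtain h where h: "\<And>a. a \<in> carrier A \<Longrightarrow> P a (h a)" by metis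
  obtain f where f: "bij_betw f {0..<n} (carrier A)"
    using ex_bij_betw_nat_finite[OF A(2)] by (auto simp: n_def order_def)
  have f_closed: "f (k mod n) \<in> carrier A" for k
    using bij_betwE[OF f] n by simp
  have "ulm_extension A l e (\<lambda>k. h (f (k mod n)))"
  proof unfold_locales
    fix k x y assume "x \<in> carrier A" "y \<in> carrier A"
    then show "int l ^ e dvd h (f (k mod n)) (x \<otimes>\<^bsub>A\<^esub> y) - h (f (k mod n)) x - h (f (k mod n)) y"
      using h[OF f_closed[of k]] by (simp add: P_def)
  next
    fix a K assume a: "a \<in> carrier A" "a \<noteq> \<one>\<^bsub>A\<^esub>"
    from a(1) have "a \<in> f ` {0..<n}" using f by (simp add: bij_betw_def)
    then obtain j where j: "j < n" "f j = a" by auto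
    \<comment> \<open>This index lies beyond \<open>K\<close> and carries the character chosen for
      \<open>a = f j\<close>.\<close>
    have "K * n + j \<ge> K" using n by (simp add: trans_le_add1)
    moreover have "(K * n + j) mod n = j" using j by simp
    ultimately show "\<exists>k\<ge>K. \<not> int l ^ e dvd h (f (k mod n)) a"
      using h[OF a(1)] a(2) j(2) by (intro exI[of _ "K * n + j"]) (simp add: P_def)
  qed (fact l A(2) order)+
  then show ?thesis using ulm_extension.good_extension_D by blast
qed

theorem theorem4:
  fixes l :: nat and A :: "'a monoid"
  assumes "Factorial_Ring.prime l"
    and "comm_group A" and "finite (carrier A)" and "\<exists>n. card (carrier A) = l ^ n"
  shows "(\<exists>(D :: ((nat \<Rightarrow> int) \<times> 'a) monoid) TG. good_extension l A D TG) \<and>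
         (\<forall>(D1 :: 'b monoid) TG1 (D2 :: 'c monoid) TG2.
            good_extension l A D1 TG1 \<and> good_extension l A D2 TG2 \<longrightarrow>
            top_group_iso D1 TG1 D2 TG2)"
proof (intro conjI allI impI)
  show "\<exists>(D :: ((nat \<Rightarrow> int) \<times> 'a) monoid) TG. good_extension l A D TG"
    using good_extension_exists assms by blast
next
  fix D1 :: "'b monoid" and TG1 and D2 :: "'c monoid" and TG2
  assume good: "good_extension l A D1 TG1 \<and> good_extension l A D2 TG2"
  have l: "1 < l" using assms(1) by (rule prime_gt_1_nat)
  have A: "group A" using assms(2) by (rule comm_group.axioms)
  obtain i1 p1 where "tl_extension A D1 l TG1 i1 p1"
    using good_extension_imp_tl_extension[OF l A] good by blast
  moreover obtain i2 p2 where "tl_extension A D2 l TG2 i2 p2"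
    using good_extension_imp_tl_extension[OF l A] good by blast
  ultimately have "two_tl_extensions A l D1 TG1 i1 p1 D2 TG2 i2 p2"
    by (rule two_tl_extensions.intro)
  then show "top_group_iso D1 TG1 D2 TG2"
    by (rule two_tl_extensions.top_group_iso)
qed

end
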